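(* Let $1<p<\infty$, $0<T<\infty$, and let $A$ be a Young's function. If $\nu\in L^1(0,T)$, $\nu>0$, is such that, for some $0<\tau_0\le T$: (a) $x\mapsto\nu(x)$ is decreasing in $(0,\tau_0)$; (b) $x\mapsto\nu(x)$ is bounded in $(\tau_0,T)$ (in the case $\tau_0<T$); (c) for some $c_\nu>0$, $$N(t)\le c_\nu\, t\,A^{-1}\!\left(\frac1t\right)\qquad\forall t\in(0,\tau_0),\qquad\text{where } N(t)=\int_0^t\nu(\sigma)\,d\sigma,$$ then, setting $$J_\nu g(t)=\int_0^t\nu(t-s)g(s)\,ds,\qquad t\in(0,T),$$ it is, for every $g\in L^p(0,T)$, $$\|J_\nu g\|_{C}\le c\left(\nu(\cdot),A(\cdot),p,T\right)\|g\|_{p},$$ where $c(\nu(\cdot),A(\cdot),p,T)$ is a constant depending only on $\nu,A,p,T$, and $C$ is the Young's function defined by $$C^{-1}(x)=\int_0^x t^{-2+\frac1p}A^{-1}(t)\,dt,\qquad x\ge0.$$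
   Context: A Young's function is a convex function $A$ defined on $[0,\infty[$ such that $A(0)=0$ and $A(x)>0$ for $x>0$; such functions are strictly increasing and invertible, and $A^{-1}$, defined in $[0,\infty[$, denotes the inverse. For a Young's function $A$, the Orlicz space $L^A(0,T)$ is the space of all real-valued Lebesgue measurable functions $f$ on $(0,T)$ such that $\|f\|_A=\|f\|_{L^A(0,T)}:=\inf\{\lambda>0:\int_0^T A(|f(t)|/\lambda)\,dt\le1\}<\infty$ (with the convention $\inf\emptyset=+\infty$). $\|\cdot\|_p$ is the norm of the Lebesgue space $L^p(0,T)$. *)

theory Defs
  imports "HOL-Analysis.Analysis"
begin

text \<open>
  Functions on \<open>[0,\<infinity>)\<close> or on \<open>(0,T)\<close> are represented by total functions of type
  \<open>real \<Rightarrow> real\<close>; their values outside the stated domain are irrelevant.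
\<close>

definition young_function :: "(real \<Rightarrow> real) \<Rightarrow> bool" where
  "young_function A \<longleftrightarrow> convex_on {0..} A \<and> A 0 = 0 \<and> (\<forall>x>0. 0 < A x)"

text \<open>A Young's function is a bijection of \<open>[0,\<infinity>)\<close> onto itself; this is its inverse there.\<close>

definition young_inv :: "(real \<Rightarrow> real) \<Rightarrow> real \<Rightarrow> real" where
  "young_inv A = inv_into {0..} A"

text \<open>The infimum is taken in \<open>[0,\<infinity>]\<close>, so that the infimum of the empty set is \<open>\<infinity>\<close>.\<close>

definition orlicz_norm :: "(real \<Rightarrow> real) \<Rightarrow> real \<Rightarrow> (real \<Rightarrow> real) \<Rightarrow> ennreal" where
  "orlicz_norm A T f =
     (INF l\<in>{l. 0 < l \<and> (\<integral>\<^sup>+ t. ennreal (A (\<bar>f t\<bar> / l)) \<partial>lebesgue_on {0<..<T}) \<le> 1}. ennreal l)"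

definition orlicz_space :: "(real \<Rightarrow> real) \<Rightarrow> real \<Rightarrow> (real \<Rightarrow> real) set" where
  "orlicz_space A T =
     {f. f \<in> borel_measurable (lebesgue_on {0<..<T}) \<and> orlicz_norm A T f < \<infinity>}"

definition Lp_space :: "real \<Rightarrow> real \<Rightarrow> (real \<Rightarrow> real) set" where
  "Lp_space p T =
     {f. f \<in> borel_measurable (lebesgue_on {0<..<T}) \<and>
         integrable (lebesgue_on {0<..<T}) (\<lambda>t. \<bar>f t\<bar> powr p)}"

definition Lp_norm :: "real \<Rightarrow> real \<Rightarrow> (real \<Rightarrow> real) \<Rightarrow> real" where
  "Lp_norm p T f = (LINT t|lebesgue_on {0<..<T}. \<bar>f t\<bar> powr p) powr (1 / p)"

definition primitive :: "(real \<Rightarrow> real) \<Rightarrow> real \<Rightarrow> real" where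
  "primitive \<nu> t = (LINT \<sigma>|lebesgue_on {0<..<t}. \<nu> \<sigma>)"

text \<open>
  The value is meaningful only for those \<open>t\<close> for which the integrand is integrable; the Bochner
  integral is \<open>0\<close> otherwise.
\<close>

definition J_op :: "(real \<Rightarrow> real) \<Rightarrow> (real \<Rightarrow> real) \<Rightarrow> real \<Rightarrow> real" where
  "J_op \<nu> g t = (LINT s|lebesgue_on {0<..<t}. \<nu> (t - s) * g s)"

text \<open>
  \<open>C\<close> is the Young's function whose inverse is
  \<open>x \<mapsto> \<integral>\<^sub>0\<^sup>x t\<^bsup>-2 + 1/p\<^esup> A\<^sup>-\<^sup>1(t) dt\<close>. Convergence of the integral is part of the condition
  (it can fail at \<open>0\<close>), and \<open>C\<close> being finite on \<open>[0,\<infinity>)\<close> forces the integral to be unbounded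
  in \<open>x\<close>. Such a \<open>C\<close> is determined on \<open>[0,\<infinity>)\<close> by \<open>A\<close> and \<open>p\<close>.
\<close>

definition target_young :: "real \<Rightarrow> (real \<Rightarrow> real) \<Rightarrow> (real \<Rightarrow> real) \<Rightarrow> bool" where
  "target_young p A C \<longleftrightarrow> young_function C \<and>
     (\<forall>x\<ge>0. has_bochner_integral (lebesgue_on {0<..<x})
        (\<lambda>t. t powr (-2 + 1 / p) * young_inv A t) (young_inv C x))"

end

theory Submission
  imports Defs
begin

text \<open>
  Write \<open>B\<close> and \<open>D\<close> for the inverses of \<open>A\<close> and \<open>C\<close>, so that
  \<open>D(x) = \<integral>\<^sub>0\<^sup>x t\<^bsup>-2 + 1/p\<^esup> B(t) dt\<close>, let \<open>q\<close> be the exponent conjugate to \<open>p\<close>, and assume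
  \<open>\<parallel>g\<parallel>\<^sub>p \<le> 1\<close>. The proof estimates the distribution function of \<open>J g\<close> at the level
  \<open>K D(x)\<close> for each large \<open>x\<close>, by cutting the kernel at \<open>1/x\<close> and the function at the matching
  height \<open>x\<^bsup>1/p\<^esup>\<close>. The convolution then has one essential part and three parts bounded by multiples of
  \<open>D(x)\<close> (lemma \<open>convolution_split\<close>):

  \<^item> For \<open>\<nu>\<close> on \<open>(0, 1/x)\<close> and \<open>\<bar>g\<bar> \<le> x\<^bsup>1/p\<^esup>\<close> the bound is \<open>N(1/x) x\<^bsup>1/p\<^esup> \<le> c B(x) x\<^bsup>1/p - 1\<^esup>\<close>, and this is at
    most \<open>c D(x)\<close>, because the integrand that defines \<open>D\<close> is decreasing
    (lemma \<open>target_young_lower\<close>).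
  \<^item> On \<open>[1/x, \<tau>)\<close> monotonicity gives \<open>\<nu>(s) \<le> N(s)/s \<le> c B(1/s)\<close>, and Hoelder's inequality
    applies because the \<open>L\<^sup>q\<close> norm of \<open>s \<mapsto> B(1/s)\<close> on this interval is at most \<open>D(x)\<close>
    (lemma \<open>kernel_tail\<close>).
  \<^item> Beyond \<open>\<tau>\<close> the kernel is bounded, so this part is a constant, hence at most a multiple of
    \<open>D(1/\<tau>) \<le> D(x)\<close>.

  So \<open>\<bar>J g\<bar> > K D(x)\<close> forces the remaining part, \<open>\<nu>\<close> on \<open>(0, 1/x)\<close> against the values of \<open>\<bar>g\<bar>\<close> above
  \<open>x\<^bsup>1/p\<^esup>\<close>, to exceed \<open>c D(x)\<close>. Its \<open>L\<^sup>1\<close> norm is \<open>N(1/x)\<close> times the integral of those values, so by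
  Markov's inequality
  \<open>\<bar>{\<bar>J g\<bar> > K D(x)}\<bar> \<le> x\<^bsup>-1/p\<^esup> \<integral> \<bar>g\<bar> 1{\<bar>g\<bar> > x\<^bsup>1/p\<^esup>}\<close>.
  Since \<open>C(\<bar>J g\<bar>/K) > x\<close> is the same as \<open>\<bar>J g\<bar> > K D(x)\<close>, integrating over \<open>x > 1/\<tau>\<close> and exchanging
  the integrals gives at most \<open>q \<integral> \<bar>g\<bar>\<^sup>p\<close>; the levels \<open>x \<le> 1/\<tau>\<close> cost at most \<open>T/\<tau>\<close>
  (lemma \<open>convolution_modular_bound\<close>). A modular bounded by \<open>k \<ge> 1\<close> gives a norm bounded by \<open>k K\<close>, as
  \<open>C\<close> is convex with \<open>C(0) = 0\<close>.

  The constants involve \<open>\<nu>\<close>, \<open>A\<close>, \<open>p\<close>, \<open>T\<close> only, as the lower bound for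
  \<open>D(1/\<tau>)\<close> is given in terms of \<open>A\<close>.
\<close>

section \<open>Young functions and their inverses\<close>

text \<open>
  Since \<open>A(0) = 0\<close>, this is convexity on the segment from \<open>0\<close> to \<open>x\<close>. Strict monotonicity, the decrease of
  \<open>A\<^sup>-\<^sup>1(u) / u\<close> and the rescaling of modulars all come from it.
\<close>

lemma young_scale:
  assumes "young_function A" "0 \<le> r" "r \<le> 1" "0 \<le> x"
  shows "A (r * x) \<le> r * A x"
proof -
  have "A ((1 - r) *\<^sub>R 0 + r *\<^sub>R x) \<le> (1 - r) * A 0 + r * A x"
    using assms by (intro convex_onD[of "{0..}"]) (auto simp: young_function_def)
  then show ?thesis
    using assms by (simp add: young_function_def)
qed

lemma young_nonneg: "young_function A \<Longrightarrow> 0 \<le> x \<Longrightarrow> 0 \<le> A x"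
  by (cases "x = 0") (auto simp: young_function_def less_imp_le)

lemma young_strict_mono:
  assumes A: "young_function A"
  shows "strict_mono_on {0..} A"
proof (rule strict_mono_onI)
  fix x y :: real assume "x \<in> {0..}" "y \<in> {0..}" "x < y"
  then have "0 \<le> x" "0 < y" by auto
  have "A x \<le> x / y * A y"
    using young_scale[OF A, of "x / y" y] \<open>0 \<le> x\<close> \<open>x < y\<close> by simp
  also have "\<dots> < 1 * A y"
    using \<open>0 \<le> x\<close> \<open>x < y\<close> A by (intro mult_strict_right_mono) (auto simp: young_function_def)
  finally show "A x < A y" by simp
qed

text \<open>
  Convexity gives continuity only on the open half-line, so the intermediate value theorem is
  applied on an interval \<open>[a, b]\<close> with \<open>a > 0\<close>. Linear comparison with the chord through \<open>0\<close> and \<open>1\<close> shows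
  that \<open>A(a) \<le> y \<le> A(b)\<close>.
\<close>

lemma young_surj:
  assumes A: "young_function A" and "0 \<le> y"
  shows "\<exists>x\<ge>0. A x = y"
proof (cases "y = 0")
  case True
  then show ?thesis using A by (auto simp: young_function_def)
next
  case False
  then have y: "0 < y" using \<open>0 \<le> y\<close> by simp
  have A1: "0 < A 1" using A by (simp add: young_function_def)
  define a b where "a = min 1 (y / A 1)" and "b = max 1 (y / A 1)"
  have a: "0 < a" "a \<le> 1" "a \<le> y / A 1" and b: "1 \<le> b" "y / A 1 \<le> b"
    using y A1 by (auto simp: a_def b_def)
  have "A a \<le> a * A 1" using young_scale[OF A, of a 1] a by simp
  then have Aa: "A a \<le> y" using a A1 by (simp add: field_simps)
  have "A 1 \<le> 1 / b * A b" using young_scale[OF A, of "1 / b" b] b by simp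
  then have "b * A 1 \<le> A b" using b by (simp add: field_simps)
  then have Ab: "y \<le> A b" using b A1 by (simp add: field_simps)
  have "convex_on {0..} A" using A by (simp add: young_function_def)
  then have "convex_on {0<..} A" by (rule convex_on_subset) auto
  then have "continuous_on {0<..} A" by (intro convex_on_continuous) auto
  then have "continuous_on {a..b} A" by (rule continuous_on_subset) (use a in auto)
  moreover have "a \<le> b" using a b by simp
  ultimately obtain x where "a \<le> x" "A x = y"
    using IVT'[of A a y b, OF Aa Ab] by blast
  then show ?thesis using a by (intro exI[of _ x]) auto
qed

lemma young_inv_nonneg: "young_function A \<Longrightarrow> 0 \<le> y \<Longrightarrow> 0 \<le> young_inv A y"
  using young_surj[of A y] inv_into_into[of y A "{0..}"] by (auto simp: young_inv_def)

lemma young_young_inv: "young_function A \<Longrightarrow> 0 \<le> y \<Longrightarrow> A (young_inv A y) = y"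
  using young_surj[of A y] f_inv_into_f[of y A "{0..}"] by (auto simp: young_inv_def)

lemma young_less_iff:
  assumes "young_function A" "0 \<le> x" "0 \<le> y"
  shows "A x < A y \<longleftrightarrow> x < y"
  using strict_mono_on_less[OF young_strict_mono[OF assms(1)], of x y] assms by simp

text \<open>
  The Galois connection that turns level sets of \<open>A \<circ> Y\<close> into level sets of \<open>Y\<close>.
\<close>

lemma young_inv_less_iff:
  assumes "young_function A" "0 \<le> x" "0 \<le> y"
  shows "young_inv A x < y \<longleftrightarrow> x < A y"
  using young_less_iff[OF assms(1) young_inv_nonneg[OF assms(1,2)] assms(3)]
  by (simp add: young_young_inv assms)

lemma young_inv_mono:
  assumes "young_function A" "0 \<le> x" "x \<le> y"
  shows "young_inv A x \<le> young_inv A y"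
  using young_less_iff[OF assms(1), of "young_inv A y" "young_inv A x"] assms
    young_inv_nonneg[OF assms(1), of x] young_inv_nonneg[OF assms(1), of y]
    young_young_inv[OF assms(1), of x] young_young_inv[OF assms(1), of y]
  by linarith

lemma young_inv_pos: "young_function A \<Longrightarrow> 0 < y \<Longrightarrow> 0 < young_inv A y"
  using young_young_inv[of A y] young_inv_nonneg[of A y]
  by (cases "young_inv A y = 0") (auto simp: young_function_def)

text \<open>
  The quotient \<open>A\<^sup>-\<^sup>1(u) / u\<close> is decreasing, since a concave function that vanishes at \<open>0\<close> has decreasing
  slopes from the origin.
\<close>

lemma young_inv_ratio:
  assumes A: "young_function A" and "0 \<le> v" "v \<le> u"  "0 < u"
  shows "v / u * young_inv A u \<le> young_inv A v"
proof (rule ccontr)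
  assume "\<not> ?thesis"
  then have "young_inv A v < v / u * young_inv A u" by simp
  then have "v < A (v / u * young_inv A u)"
    using young_inv_less_iff[OF A, of v "v / u * young_inv A u"] assms
    by (simp add: young_inv_nonneg)
  also have "\<dots> \<le> v / u * A (young_inv A u)"
    using assms by (intro young_scale) (auto simp: young_inv_nonneg)
  also have "\<dots> = v" using assms by (simp add: young_young_inv)
  finally show False by simp
qed

text \<open>
  The values of \<open>young_inv A\<close> at negative numbers carry no information, so the argument is clipped at
  \<open>0\<close>; the clipped function is monotone on the whole line.
\<close>

lemma borel_measurable_young_inv_max:
  assumes A: "young_function A" and h: "h \<in> borel_measurable M"
  shows "(\<lambda>y. young_inv A (max 0 (h y))) \<in> borel_measurable M"
proof -
  have "(\<lambda>y. young_inv A (max 0 y)) \<in> borel_measurable borel"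
    using A by (intro borel_measurable_mono monoI young_inv_mono) auto
  from measurable_compose[OF h this] show ?thesis .
qed

text \<open>
  The layer cake formula for \<open>C \<circ> Y\<close>, with the level set \<open>{C(Y) > x}\<close> written as \<open>{Y > C\<^sup>-\<^sup>1(x)}\<close>. This
  expresses the modular through the inverse of \<open>C\<close>, which is what the hypotheses describe.
\<close>

lemma nn_integral_young_layer_cake:
  fixes Y :: "real \<Rightarrow> real"
  assumes C: "young_function C" and [measurable]: "Y \<in> borel_measurable borel" and Y0: "\<And>t. 0 \<le> Y t"
  shows "(\<integral>\<^sup>+t. ennreal (C (Y t)) * indicator {a<..<b} t \<partial>lborel)
    = (\<integral>\<^sup>+x. indicator {0<..} x * (\<integral>\<^sup>+t. indicator {a<..<b} t * indicator {young_inv C (max 0 x)<..} (Y t) \<partial>lborel) \<partial>lborel)"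
proof -
  note [measurable (raw)] = borel_measurable_young_inv_max[OF C]
  have "(\<integral>\<^sup>+x. indicator {0<..} x * (\<integral>\<^sup>+t. indicator {a<..<b} t * indicator {young_inv C (max 0 x)<..} (Y t) \<partial>lborel) \<partial>lborel)
      = (\<integral>\<^sup>+x. (\<integral>\<^sup>+t. indicator {0<..} x * (indicator {a<..<b} t * indicator {young_inv C (max 0 x)<..} (Y t)) \<partial>lborel) \<partial>lborel)"
    by (intro nn_integral_cong nn_integral_cmult[symmetric]) (simp add: indicator_def greaterThan_def)
  also have "\<dots> = (\<integral>\<^sup>+t. (\<integral>\<^sup>+x. indicator {0<..} x * (indicator {a<..<b} t * indicator {young_inv C (max 0 x)<..} (Y t)) \<partial>lborel) \<partial>lborel)"
    by (rule lborel_pair.Fubini') (simp add: indicator_def greaterThan_def)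
  also have "\<dots> = (\<integral>\<^sup>+t. (\<integral>\<^sup>+x. indicator {a<..<b} t * indicator {0<..<C (Y t)} x \<partial>lborel) \<partial>lborel)"
    using young_inv_less_iff[OF C _ Y0]
    by (intro nn_integral_cong) (auto simp: indicator_def max_def)
  also have "\<dots> = (\<integral>\<^sup>+t. ennreal (C (Y t)) * indicator {a<..<b} t \<partial>lborel)"
    using young_nonneg[OF C Y0]
    by (intro nn_integral_cong) (simp add: nn_integral_cmult mult.commute)
  finally show ?thesis by simp
qed

section \<open>The inverse of the target function\<close>

lemma target_young_nn_integral:
  assumes C: "target_young p A C" and A: "young_function A" and "0 \<le> x"
  shows "(\<integral>\<^sup>+t. ennreal (t powr (-2 + 1 / p) * young_inv A (max 0 t)) * indicator {0<..<x} t \<partial>lborel)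
     = ennreal (young_inv C x)"
proof -
  let ?m = "\<lambda>t. t powr (-2 + 1 / p) * young_inv A t"
  have *: "has_bochner_integral (lebesgue_on {0<..<x}) ?m (young_inv C x)"
    using C \<open>0 \<le> x\<close> by (auto simp: target_young_def)
  have "ennreal (young_inv C x) = (\<integral>\<^sup>+t. ennreal (?m t) \<partial>lebesgue_on {0<..<x})"
    using * A by (subst nn_integral_eq_integral)
     (auto simp: has_bochner_integral_iff young_inv_nonneg intro!: AE_I2)
  also have "\<dots> = (\<integral>\<^sup>+t. ennreal (?m t) * indicator {0<..<x} t \<partial>lborel)"
    by (subst nn_integral_restrict_space) (auto simp: nn_integral_completion)
  also have "\<dots> = (\<integral>\<^sup>+t. ennreal (t powr (-2 + 1 / p) * young_inv A (max 0 t)) * indicator {0<..<x} t \<partial>lborel)"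
    by (intro nn_integral_cong) (auto simp: indicator_def max_def)
  finally show ?thesis by simp
qed

text \<open>
  The integrand \<open>t\<^bsup>-2 + 1/p\<^esup> A\<^sup>-\<^sup>1(t)\<close> is the product of the decreasing functions \<open>t\<^bsup>-1 + 1/p\<^esup>\<close> and
  \<open>A\<^sup>-\<^sup>1(t) / t\<close>, so its integral over \<open>(0, u)\<close> is at least \<open>u\<close> times its value at \<open>u\<close>.
\<close>

lemma target_young_lower:
  assumes C: "target_young p A C" and A: "young_function A" and p: "1 < p" and "0 < u"
  shows "young_inv A u * u powr (1 / p - 1) \<le> young_inv C u"
proof -
  let ?m = "\<lambda>t. t powr (-2 + 1 / p) * young_inv A (max 0 t)"
  have "ennreal (young_inv A u * u powr (1 / p - 1)) = ennreal (?m u * u)"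
    using \<open>0 < u\<close> powr_add[of u "-2 + 1/p" 1] by (simp add: max_def ac_simps)
  also have "\<dots> = (\<integral>\<^sup>+t. ennreal (?m u) * indicator {0<..<u} t \<partial>lborel)"
    using A \<open>0 < u\<close> by (simp add: nn_integral_cmult_indicator ennreal_mult young_inv_nonneg)
  also have "\<dots> \<le> (\<integral>\<^sup>+t. ennreal (?m t) * indicator {0<..<u} t \<partial>lborel)"
  proof (intro nn_integral_mono)
    fix t :: real
    show "ennreal (?m u) * indicator {0<..<u} t \<le> ennreal (?m t) * indicator {0<..<u} t"
    proof (cases "t \<in> {0<..<u}")
      case True
      have "u powr (-2 + 1 / p) * u \<le> t powr (-2 + 1 / p) * t"
        using True p powr_mono2'[of "-1 + 1 / p" t u] powr_add[of t "-2 + 1/p" 1] powr_add[of u "-2 + 1/p" 1]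
        by (simp add: field_simps)
      then have "(u powr (-2 + 1 / p) * u) * (young_inv A u / u) \<le> (t powr (-2 + 1 / p) * t) * (young_inv A u / u)"
        using True A by (intro mult_right_mono) (auto simp: young_inv_nonneg)
      also have "\<dots> = t powr (-2 + 1 / p) * (t / u * young_inv A u)"
        by simp
      also have "\<dots> \<le> t powr (-2 + 1 / p) * young_inv A t"
        using True A by (intro mult_left_mono young_inv_ratio) auto
      finally show ?thesis
        using True by (simp add: max_def ennreal_leI)
    qed simp
  qed
  also have "\<dots> = ennreal (young_inv C u)"
    using assms by (intro target_young_nn_integral) auto
  finally show ?thesis
    using C \<open>0 < u\<close> by (subst (asm) ennreal_le_iff) (auto simp: young_inv_nonneg target_young_def)
qed

text \<open>
  The map \<open>s \<mapsto> 1/s\<close> reverses the order, so the substitution is \<open>s \<mapsto> - 1/s\<close>, which is increasing,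
  followed by a reflection.
\<close>

lemma nn_integral_reciprocal:
  fixes h :: "real \<Rightarrow> real"
  assumes [measurable]: "h \<in> borel_measurable borel" and "0 < a" "a \<le> b"
  shows "(\<integral>\<^sup>+s. ennreal (h (1 / s) / s\<^sup>2) * indicator {a..b} s \<partial>lborel)
       = (\<integral>\<^sup>+u. ennreal (h u) * indicator {1 / b..1 / a} u \<partial>lborel)"
proof -
  let ?g = "\<lambda>s::real. - (1 / s)"
  have "(\<integral>\<^sup>+u. ennreal (h u) * indicator {1 / b..1 / a} u \<partial>lborel)
      = (\<integral>\<^sup>+y. ennreal (h (- y)) * indicator {1 / b..1 / a} (- y) \<partial>lborel)"
    by (subst nn_integral_real_affine[where c = "-1" and t = 0]) auto
  also have "\<dots> = (\<integral>\<^sup>+y. ennreal (h (- y) * indicator {?g a..?g b} y) \<partial>lborel)"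
    by (intro nn_integral_cong) (auto simp: indicator_def)
  also have "\<dots> = (\<integral>\<^sup>+s. ennreal (h (- ?g s) * (1 / s\<^sup>2) * indicator {a..b} s) \<partial>lborel)"
    using assms by (intro nn_integral_substitution)
      (auto simp: set_borel_measurable_def power2_eq_square
        intro!: derivative_eq_intros continuous_intros)
  also have "\<dots> = (\<integral>\<^sup>+s. ennreal (h (1 / s) / s\<^sup>2) * indicator {a..b} s \<partial>lborel)"
    by (intro nn_integral_cong) (auto simp: indicator_def)
  finally show ?thesis by simp
qed

text \<open>
  The \<open>q\<close>-th power of \<open>A\<^sup>-\<^sup>1(1/s)\<close> is a product, and the factor with exponent \<open>q - 1\<close> is bounded by
  \<open>C\<^sup>-\<^sup>1(x)\<^bsup>q - 1\<^esup> (1/s)\<^bsup>1/p\<^esup>\<close> through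
  \<open>target_young_lower\<close>. What is left is the integral of \<open>(1/s)\<^bsup>1/p\<^esup> A\<^sup>-\<^sup>1(1/s)\<close>, which the substitution
  \<open>u = 1/s\<close> turns into part of the integral that defines \<open>C\<^sup>-\<^sup>1(x)\<close>.
\<close>

lemma kernel_tail:
  fixes p q :: real
  assumes C: "target_young p A C" and A: "young_function A" and p: "1 < p" and q: "q = p / (p - 1)"
    and "0 < x"
  shows "(\<integral>\<^sup>+s. ennreal (young_inv A (max 0 (1 / s)) powr q) * indicator {1 / x..b} s \<partial>lborel)
     \<le> ennreal (young_inv C x powr q)"
proof (cases "1 / x \<le> b")
  case False
  then show ?thesis by (simp add: indicator_def)
next
  case b: True
  let ?B = "young_inv A" and ?D = "young_inv C"
  have q1: "1 < q" "1 / q = 1 - 1 / p" "(q - 1) * (1 - 1 / p) = 1 / p"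
    using p by (auto simp: q field_simps)
  have CY: "young_function C" using C by (simp add: target_young_def)
  have "0 < 1 / x" using \<open>0 < x\<close> by simp
  have m_meas: "(\<lambda>u. u powr (- 2 + 1 / p) * ?B (max 0 u)) \<in> borel_measurable borel"
    by (intro borel_measurable_times borel_measurable_young_inv_max[OF A]) auto
  note [measurable (raw)] = borel_measurable_young_inv_max[OF A]
  have "(\<integral>\<^sup>+s. ennreal (?B (max 0 (1 / s)) powr q) * indicator {1 / x..b} s \<partial>lborel)
     \<le> (\<integral>\<^sup>+s. ennreal (?D x powr (q - 1)) *
          (ennreal ((1 / s) powr (- 2 + 1 / p) * ?B (max 0 (1 / s)) / s\<^sup>2) * indicator {1 / x..b} s) \<partial>lborel)"
  proof (intro nn_integral_mono)
    fix s :: real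
    show "ennreal (?B (max 0 (1 / s)) powr q) * indicator {1 / x..b} s
     \<le> ennreal (?D x powr (q - 1)) *
          (ennreal ((1 / s) powr (- 2 + 1 / p) * ?B (max 0 (1 / s)) / s\<^sup>2) * indicator {1 / x..b} s)"
    proof (cases "s \<in> {1 / x..b}")
      case True
      then have s0: "0 < s" using less_le_trans[OF \<open>0 < 1 / x\<close>, of s] by simp
      then have s: "0 < s" "1 / s \<le> x" using \<open>0 < x\<close> True by (auto simp: field_simps)
      let ?u = "1 / s"
      have B0: "0 < ?B ?u" using s A by (intro young_inv_pos) auto
      have D0: "0 \<le> ?D x" using CY \<open>0 < x\<close> by (intro young_inv_nonneg) auto
      have "?B ?u * ?u powr (1 / p - 1) \<le> ?D ?u"
        using target_young_lower[OF C A p, of ?u] s by simp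
      also have "\<dots> \<le> ?D x"
        using s CY by (intro young_inv_mono) auto
      finally have "?B ?u * ?u powr (1 / p - 1) \<le> ?D x" by simp
      then have "(?B ?u * ?u powr (1 / p - 1)) * ?u powr (1 - 1 / p) \<le> ?D x * ?u powr (1 - 1 / p)"
        by (intro mult_right_mono) auto
      then have "?B ?u \<le> ?D x * ?u powr (1 - 1 / p)"
        using s by (simp add: mult.assoc powr_add[symmetric])
      then have "?B ?u powr (q - 1) \<le> (?D x * ?u powr (1 - 1 / p)) powr (q - 1)"
        using B0 q1 by (intro powr_mono2) auto
      also have "\<dots> = ?D x powr (q - 1) * ?u powr (1 / p)"
        using D0 s q1 by (simp add: powr_mult powr_powr mult.commute)
      finally have *: "?B ?u powr (q - 1) \<le> ?D x powr (q - 1) * ?u powr (1 / p)" .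
      have "?B ?u powr q = ?B ?u powr (q - 1) * ?B ?u"
        using B0 powr_add[of "?B ?u" "q - 1" 1] by simp
      also have "\<dots> \<le> ?D x powr (q - 1) * ?u powr (1 / p) * ?B ?u"
        using * B0 by (intro mult_right_mono) auto
      also have "?u powr (1 / p) = ?u powr (- 2 + 1 / p) * ?u powr 2"
        using powr_add[of ?u "-2 + 1 / p" 2] by simp
      also have "?u powr 2 = 1 / s\<^sup>2"
        using s by (simp add: powr_numeral power_divide)
      finally have "?B ?u powr q \<le> ?D x powr (q - 1) * (?u powr (- 2 + 1 / p) * ?B ?u / s\<^sup>2)"
        by (simp add: algebra_simps)
      then have "ennreal (?B ?u powr q) \<le> ennreal (?D x powr (q - 1)) * ennreal (?u powr (- 2 + 1 / p) * ?B ?u / s\<^sup>2)"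
        using B0 by (subst ennreal_mult[symmetric]) (auto intro!: ennreal_leI)
      then show ?thesis using True s by (simp add: max_def)
    qed simp
  qed
  also have "\<dots> = ennreal (?D x powr (q - 1)) *
          (\<integral>\<^sup>+s. ennreal ((1 / s) powr (- 2 + 1 / p) * ?B (max 0 (1 / s)) / s\<^sup>2) * indicator {1 / x..b} s \<partial>lborel)"
    by (intro nn_integral_cmult) measurable
  also have "(\<integral>\<^sup>+s. ennreal ((1 / s) powr (- 2 + 1 / p) * ?B (max 0 (1 / s)) / s\<^sup>2) * indicator {1 / x..b} s \<partial>lborel)
     = (\<integral>\<^sup>+u. ennreal (u powr (- 2 + 1 / p) * ?B (max 0 u)) * indicator {1 / b..1 / (1 / x)} u \<partial>lborel)"
    using nn_integral_reciprocal[OF m_meas \<open>0 < 1 / x\<close> b] .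
  also have "\<dots> \<le> (\<integral>\<^sup>+u. ennreal (u powr (- 2 + 1 / p) * ?B (max 0 u)) * indicator {0<..<x} u \<partial>lborel)"
  proof (intro nn_integral_mono_AE)
    have "0 < b" using b \<open>0 < 1 / x\<close> by linarith
    show "AE u in lborel. ennreal (u powr (- 2 + 1 / p) * ?B (max 0 u)) * indicator {1 / b..1 / (1 / x)} u
       \<le> ennreal (u powr (- 2 + 1 / p) * ?B (max 0 u)) * indicator {0<..<x} u"
      using AE_lborel_singleton[of x]
    proof eventually_elim
      case (elim u)
      have "1 / b \<le> u \<Longrightarrow> 0 < u" using \<open>0 < b\<close> by (meson less_le_trans zero_less_divide_1_iff)
      then show ?case using elim by (auto simp: indicator_def)
    qed
  qed
  also have "\<dots> = ennreal (?D x)"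
    using assms by (intro target_young_nn_integral) auto
  also have "ennreal (?D x powr (q - 1)) * ennreal (?D x) = ennreal (?D x powr q)"
    using young_inv_pos[OF CY \<open>0 < x\<close>] powr_add[of "?D x" "q - 1" 1]
    by (simp add: ennreal_mult[symmetric])
  finally show ?thesis by (simp add: mult_left_mono)
qed

section \<open>Convolutions and large values\<close>

lemma nn_integral_shift:
  fixes F :: "real \<Rightarrow> ennreal"
  assumes [measurable]: "F \<in> borel_measurable borel"
  shows "(\<integral>\<^sup>+s. F (t - s) \<partial>lborel) = (\<integral>\<^sup>+s. F s \<partial>lborel)"
  using nn_integral_real_affine[of F "-1" t] by simp

lemma nn_integral_convolution:
  fixes F G :: "real \<Rightarrow> ennreal"
  assumes [measurable]: "F \<in> borel_measurable borel" "G \<in> borel_measurable borel"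
  shows "(\<integral>\<^sup>+t. (\<integral>\<^sup>+s. F s * G (t - s) \<partial>lborel) \<partial>lborel)
       = (\<integral>\<^sup>+s. F s \<partial>lborel) * (\<integral>\<^sup>+s. G s \<partial>lborel)"
proof -
  have "(\<integral>\<^sup>+t. (\<integral>\<^sup>+s. F s * G (t - s) \<partial>lborel) \<partial>lborel)
      = (\<integral>\<^sup>+s. (\<integral>\<^sup>+t. F s * G (t - s) \<partial>lborel) \<partial>lborel)"
    by (rule lborel_pair.Fubini') measurable
  also have "\<dots> = (\<integral>\<^sup>+s. F s * (\<integral>\<^sup>+t. G t \<partial>lborel) \<partial>lborel)"
  proof (intro nn_integral_cong)
    fix s :: real
    have "(\<integral>\<^sup>+t. G t \<partial>lborel) = (\<integral>\<^sup>+t. G (t - s) \<partial>lborel)"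
      using nn_integral_real_affine[of G 1 "- s"] by simp
    then show "(\<integral>\<^sup>+t. F s * G (t - s) \<partial>lborel) = F s * (\<integral>\<^sup>+t. G t \<partial>lborel)"
      by (simp add: nn_integral_cmult)
  qed
  also have "\<dots> = (\<integral>\<^sup>+s. F s \<partial>lborel) * (\<integral>\<^sup>+s. G s \<partial>lborel)"
    by (simp add: nn_integral_multc)
  finally show ?thesis .
qed

lemma nn_integral_convolution_commute:
  fixes F G :: "real \<Rightarrow> ennreal"
  assumes [measurable]: "F \<in> borel_measurable borel" "G \<in> borel_measurable borel"
  shows "(\<integral>\<^sup>+s. F (t - s) * G s \<partial>lborel) = (\<integral>\<^sup>+s. F s * G (t - s) \<partial>lborel)"
  using nn_integral_shift[of "\<lambda>s. F (t - s) * G s" t] by simp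

lemma borel_measurable_convolution:
  fixes n g :: "real \<Rightarrow> real"
  assumes [measurable]: "n \<in> borel_measurable borel" "g \<in> borel_measurable borel"
  shows "(\<lambda>t. LINT s|lborel. n (t - s) * g s) \<in> borel_measurable borel"
proof -
  have "(\<lambda>t. LINT s|lborel. n (t - s) * g s) \<in> borel_measurable lborel"
    by (rule lborel.borel_measurable_lebesgue_integral) measurable
  then show ?thesis by simp
qed

lemma nn_integral_powr_le:
  fixes a y r :: real
  assumes "0 < a" "r < 1" 
  shows "(\<integral>\<^sup>+x. ennreal (x powr (- r)) * indicator {a<..<y} x \<partial>lborel) \<le> ennreal (y powr (1 - r) / (1 - r))"
proof (cases "a < y")
  case True
  have "(\<integral>\<^sup>+x. ennreal (x powr (- r)) * indicator {a<..<y} x \<partial>lborel)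
      \<le> (\<integral>\<^sup>+x. ennreal (x powr (- r)) * indicator {a..y} x \<partial>lborel)"
    by (intro nn_integral_mono) (auto simp: indicator_def)
  also have "\<dots> = ennreal (y powr (1 - r) / (1 - r) - a powr (1 - r) / (1 - r))"
  proof (intro nn_integral_FTC_Icc)
    fix x assume "x \<in> {a..y}"
    then have "0 < x" using assms by auto
    then show "((\<lambda>x. x powr (1 - r) / (1 - r)) has_real_derivative x powr - r) (at x)"
      using DERIV_cdivide[OF has_real_derivative_powr[of x "1 - r"], of "1 - r"] assms by simp
  qed (use True assms in auto)
  also have "\<dots> \<le> ennreal (y powr (1 - r) / (1 - r))"
    using assms by (intro ennreal_leI) auto
  finally show ?thesis .
qed (simp add: indicator_def)

text \<open>
  By Tonelli the left side is the integral of \<open>f(s) \<integral> x\<^bsup>-1/p\<^esup> dx\<close>, the inner integral running over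
  \<open>a < x < f(s)\<^sup>p\<close>, and the inner integral is at most \<open>q f(s)\<^bsup>p - 1\<^esup>\<close>. This is where \<open>p > 1\<close> enters: it
  makes \<open>x\<^bsup>-1/p\<^esup>\<close> integrable at \<open>0\<close>, uniformly in \<open>a\<close>.
\<close>

lemma nn_integral_large_values:
  fixes f :: "real \<Rightarrow> real"
  assumes [measurable]: "f \<in> borel_measurable borel" and f0: "\<And>s. 0 \<le> f s"
    and p: "1 < p" and q: "q = p / (p - 1)" and a: "0 < a"
  shows "(\<integral>\<^sup>+x. ennreal (x powr (- (1 / p))) * indicator {a<..} x *
            (\<integral>\<^sup>+s. ennreal (f s) * indicator {x powr (1 / p)<..} (f s) \<partial>lborel) \<partial>lborel)
       \<le> ennreal q * (\<integral>\<^sup>+s. ennreal (f s powr p) \<partial>lborel)"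
proof -
  have q': "1 - 1 / p = 1 / q" "p * (1 / q) + 1 = p" using p by (auto simp: q field_simps)
  have q0: "0 < q" using p by (simp add: q)
  have "(\<integral>\<^sup>+x. ennreal (x powr (- (1 / p))) * indicator {a<..} x *
            (\<integral>\<^sup>+s. ennreal (f s) * indicator {x powr (1 / p)<..} (f s) \<partial>lborel) \<partial>lborel)
     = (\<integral>\<^sup>+x. (\<integral>\<^sup>+s. ennreal (x powr (- (1 / p))) * indicator {a<..} x *
            (ennreal (f s) * indicator {x powr (1 / p)<..} (f s)) \<partial>lborel) \<partial>lborel)"
    by (intro nn_integral_cong nn_integral_cmult[symmetric]) (simp add: indicator_def greaterThan_def)
  also have "\<dots> = (\<integral>\<^sup>+s. (\<integral>\<^sup>+x. ennreal (x powr (- (1 / p))) * indicator {a<..} x *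
            (ennreal (f s) * indicator {x powr (1 / p)<..} (f s)) \<partial>lborel) \<partial>lborel)"
    by (rule lborel_pair.Fubini') (simp add: indicator_def greaterThan_def)
  also have "\<dots> \<le> (\<integral>\<^sup>+s. ennreal q * ennreal (f s powr p) \<partial>lborel)"
  proof (intro nn_integral_mono)
    fix s :: real
    have "(\<integral>\<^sup>+x. ennreal (x powr (- (1 / p))) * indicator {a<..} x *
            (ennreal (f s) * indicator {x powr (1 / p)<..} (f s)) \<partial>lborel)
       \<le> (\<integral>\<^sup>+x. ennreal (f s) * (ennreal (x powr (- (1 / p))) * indicator {a<..<f s powr p} x) \<partial>lborel)"
    proof (intro nn_integral_mono)
      fix x :: real
      have "x < f s powr p" if "a < x" "x powr (1 / p) < f s"
      proof -
        have "(x powr (1 / p)) powr p < f s powr p"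
          using that p by (intro powr_less_mono2) auto
        then show ?thesis using that a p by (simp add: powr_powr)
      qed
      then show "ennreal (x powr (- (1 / p))) * indicator {a<..} x *
            (ennreal (f s) * indicator {x powr (1 / p)<..} (f s))
         \<le> ennreal (f s) * (ennreal (x powr (- (1 / p))) * indicator {a<..<f s powr p} x)"
        by (auto simp: indicator_def mult.commute)
    qed
    also have "\<dots> = ennreal (f s) * (\<integral>\<^sup>+x. ennreal (x powr (- (1 / p))) * indicator {a<..<f s powr p} x \<partial>lborel)"
      by (intro nn_integral_cmult) measurable
    also have "\<dots> \<le> ennreal (f s) * ennreal ((f s powr p) powr (1 - 1 / p) / (1 - 1 / p))"
      using a p by (intro mult_left_mono nn_integral_powr_le) auto
    also have "\<dots> = ennreal (f s * (q * f s powr (p * (1 / q))))"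
      using f0[of s] q0 unfolding q' by (simp add: ennreal_mult[symmetric] powr_powr mult.commute)
    also have "f s * (q * f s powr (p * (1 / q))) = q * f s powr p"
      using f0[of s] powr_mult_base[of "f s" "p * (1 / q)"] q' by (simp add: algebra_simps)
    also have "ennreal (q * f s powr p) = ennreal q * ennreal (f s powr p)"
      using q0 by (simp add: ennreal_mult)
    finally show "(\<integral>\<^sup>+x. ennreal (x powr (- (1 / p))) * indicator {a<..} x *
            (ennreal (f s) * indicator {x powr (1 / p)<..} (f s)) \<partial>lborel) \<le> ennreal q * ennreal (f s powr p)" .
  qed
  also have "\<dots> = ennreal q * (\<integral>\<^sup>+s. ennreal (f s powr p) \<partial>lborel)"
    by (intro nn_integral_cmult) measurable
  finally show ?thesis .
qed

section \<open>The modular estimate for Borel functions\<close>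

text \<open>
  The cut at height \<open>x\<^bsup>1/p\<^esup>\<close> for the function matches the cut at \<open>1/x\<close> for the kernel: with these
  choices every part except the singular one is controlled by \<open>C\<^sup>-\<^sup>1(x)\<close> and a constant. Pointwise Young
  inequality serves as Hoelder's inequality, since the \<open>p\<close>-norm of \<open>f\<close> is at most \<open>1\<close> and the kernel can
  be divided by \<open>C\<^sup>-\<^sup>1(x)\<close>.
\<close>

lemma convolution_split:
  fixes n f :: "real \<Rightarrow> real" and c M p q T \<tau> x :: real
  assumes C: "target_young p A C" and A: "young_function A" and p: "1 < p" and q: "q = p / (p - 1)"
    and T: "0 < T" and \<tau>: "0 < \<tau>" and c: "0 < c" and M: "0 \<le> M" and x: "1 / \<tau> < x"
    and [measurable]: "n \<in> borel_measurable borel" "f \<in> borel_measurable borel"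
    and n0: "\<And>s. 0 \<le> n s" and f0: "\<And>s. 0 \<le> f s"
    and n_neg: "\<And>s. s \<le> 0 \<Longrightarrow> n s = 0" and f_supp: "\<And>s. s \<notin> {0<..<T} \<Longrightarrow> f s = 0"
    and n_prim: "(\<integral>\<^sup>+s. ennreal (n s) * indicator {0<..<1 / x} s \<partial>lborel) \<le> ennreal (c * (1 / x) * young_inv A x)"
    and n_le: "AE s in lborel. 0 < s \<longrightarrow> s < \<tau> \<longrightarrow> n s \<le> c * young_inv A (1 / s)"
    and n_bdd: "AE s in lborel. \<tau> < s \<longrightarrow> n s \<le> M"
    and f_p: "(\<integral>\<^sup>+s. ennreal (f s powr p) \<partial>lborel) \<le> 1"
  shows "(\<integral>\<^sup>+s. ennreal (n s) * ennreal (f (t - s)) \<partial>lborel)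
     \<le> (\<integral>\<^sup>+s. (ennreal (n s) * indicator {0<..<1 / x} s) *
              (ennreal (f (t - s)) * indicator {x powr (1 / p)<..} (f (t - s))) \<partial>lborel)
       + ennreal (2 * c * young_inv C x + M * (T + 1))"
proof -
  let ?B = "young_inv A" and ?D = "young_inv C"
  have x0: "0 < x" using x \<tau> by (meson less_trans zero_less_divide_1_iff)
  have CY: "young_function C" using C by (simp add: target_young_def)
  have D0: "0 < ?D x" using young_inv_pos[OF CY x0] .
  note [measurable (raw)] = borel_measurable_young_inv_max[OF A]
  have q1: "1 < q" "1 / p + 1 / q = 1"
    using p by (auto simp: q field_simps)
  \<comment> \<open>\<open>?P\<close> is the singular part. \<open>?Q1\<close> bounds the product where \<open>s < 1/x\<close> and \<open>f\<close> is at most \<open>x\<^bsup>1/p\<^esup>\<close>,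
    \<open>?Q2 + ?Q3\<close> bound it on \<open>[1/x, \<tau>)\<close> by Young's inequality for \<open>B(1/s)/D(x)\<close> and \<open>f\<close>, and \<open>?Q4\<close>
    bounds it beyond \<open>\<tau>\<close>, where \<open>f \<le> 1 + f\<^sup>p\<close> replaces the \<open>L\<^sup>1\<close> norm by the \<open>L\<^sup>p\<close> norm.\<close>
  let ?P = "\<lambda>s. (ennreal (n s) * indicator {0<..<1 / x} s) *
              (ennreal (f (t - s)) * indicator {x powr (1 / p)<..} (f (t - s)))"
  let ?Q1 = "\<lambda>s. ennreal (x powr (1 / p)) * (ennreal (n s) * indicator {0<..<1 / x} s)"
  let ?Q2 = "\<lambda>s. ennreal (c / q * ?D x powr (1 - q)) * (ennreal (?B (max 0 (1 / s)) powr q) * indicator {1 / x..\<tau>} s)"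
  let ?Q3 = "\<lambda>s. ennreal (c / p * ?D x) * ennreal (f (t - s) powr p)"
  let ?Q4 = "\<lambda>s. ennreal M * (indicator {0<..<T} (t - s) + ennreal (f (t - s) powr p))"
  have "(\<integral>\<^sup>+s. ennreal (n s) * ennreal (f (t - s)) \<partial>lborel)
     \<le> (\<integral>\<^sup>+s. ?P s + (?Q1 s + (?Q2 s + (?Q3 s + ?Q4 s))) \<partial>lborel)"
  proof (intro nn_integral_mono_AE)
    show "AE s in lborel. ennreal (n s) * ennreal (f (t - s)) \<le> ?P s + (?Q1 s + (?Q2 s + (?Q3 s + ?Q4 s)))"
      using n_le n_bdd AE_lborel_singleton[of \<tau>]
    proof eventually_elim
      case (elim s)
      consider "s \<le> 0" | "0 < s" "s < 1 / x" | "0 < s" "1 / x \<le> s" "s < \<tau>" | "\<tau> < s"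
        using elim(3) by force
      then show ?case
      proof cases
        case 1
        then show ?thesis using n_neg by simp
      next
        case 2
        show ?thesis
        proof (cases "x powr (1 / p) < f (t - s)")
          case True
          then have "?P s = ennreal (n s) * ennreal (f (t - s))" using 2 by simp
          then show ?thesis by simp
        next
          case False
          then have "ennreal (n s) * ennreal (f (t - s)) \<le> ?Q1 s"
            using 2 n0[of s] by (simp add: mult.commute[of "ennreal (n s)"] mult_right_mono ennreal_leI)
          also have "\<dots> \<le> ?P s + (?Q1 s + (?Q2 s + (?Q3 s + ?Q4 s)))"
            by (intro add_increasing add_increasing2) auto
          finally show ?thesis .
        qed
      next
        case 3
        have B0: "0 \<le> ?B (1 / s)" using 3 A by (intro young_inv_nonneg) auto
        have "n s * f (t - s) \<le> c * ?B (1 / s) * f (t - s)"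
          using elim(1) 3 f0 by (intro mult_right_mono) auto
        also have "\<dots> = c * ?D x * ((?B (1 / s) / ?D x) * f (t - s))"
          using D0 by simp
        also have "\<dots> \<le> c * ?D x * ((?B (1 / s) / ?D x) powr q / q + f (t - s) powr p / p)"
          using B0 D0 f0 p q1 c by (intro mult_left_mono Youngs_inequality) auto
        also have "(?B (1 / s) / ?D x) powr q = ?B (1 / s) powr q / ?D x powr q"
          using B0 D0 by (simp add: powr_divide)
        also have "c * ?D x * (?B (1 / s) powr q / ?D x powr q / q + f (t - s) powr p / p)
           = c / q * ?D x powr (1 - q) * ?B (1 / s) powr q + c / p * ?D x * f (t - s) powr p"
          using D0 by (simp add: powr_diff field_simps)
        finally have "ennreal (n s * f (t - s)) \<le> ennreal (c / q * ?D x powr (1 - q) * ?B (1 / s) powr q + c / p * ?D x * f (t - s) powr p)"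
          by (rule ennreal_leI)
        also have "\<dots> = ?Q2 s + ?Q3 s"
          using 3 c D0 p q1 by (simp add: ennreal_plus ennreal_mult[symmetric] max_def)
        also have "\<dots> \<le> ?P s + (?Q1 s + (?Q2 s + (?Q3 s + ?Q4 s)))"
          by (intro add_increasing add_increasing2 add_mono order_refl) auto
        finally show ?thesis using n0 f0 by (simp add: ennreal_mult)
      next
        case 4
        have "f (t - s) \<le> indicator {0<..<T} (t - s) + f (t - s) powr p"
        proof (cases "f (t - s) \<le> 1")
          case True
          then show ?thesis using f_supp[of "t - s"] by (auto simp: indicator_def add_increasing2)
        next
          case False
          then have "f (t - s) powr 1 \<le> f (t - s) powr p" using p by (intro powr_mono) auto
          then show ?thesis using False by (auto simp: indicator_def)
        qed
        then have "n s * f (t - s) \<le> M * (indicator {0<..<T} (t - s) + f (t - s) powr p)"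
          using elim(2) 4 n0 f0 M by (intro mult_mono) auto
        then have "ennreal (n s * f (t - s)) \<le> ennreal (M * (indicator {0<..<T} (t - s) + f (t - s) powr p))"
          by (rule ennreal_leI)
        also have "\<dots> = ?Q4 s"
          using M by (simp add: ennreal_mult ennreal_plus ennreal_indicator)
        also have "\<dots> \<le> ?P s + (?Q1 s + (?Q2 s + (?Q3 s + ?Q4 s)))"
          by (intro add_increasing add_increasing2 add_mono order_refl) auto
        finally show ?thesis using n0 f0 by (simp add: ennreal_mult)
      qed
    qed
  qed
  also have "\<dots> = (\<integral>\<^sup>+s. ?P s \<partial>lborel) + ((\<integral>\<^sup>+s. ?Q1 s \<partial>lborel) + ((\<integral>\<^sup>+s. ?Q2 s \<partial>lborel) +
      ((\<integral>\<^sup>+s. ?Q3 s \<partial>lborel) + (\<integral>\<^sup>+s. ?Q4 s \<partial>lborel))))"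
    by (simp add: nn_integral_add)
  also have "\<dots> \<le> (\<integral>\<^sup>+s. ?P s \<partial>lborel) + (ennreal (c * ?D x) + (ennreal (c / q * ?D x) +
      (ennreal (c / p * ?D x) + ennreal (M * (T + 1)))))"
  proof (intro add_mono order_refl)
    have "(\<integral>\<^sup>+s. ?Q1 s \<partial>lborel) = ennreal (x powr (1 / p)) * (\<integral>\<^sup>+s. ennreal (n s) * indicator {0<..<1 / x} s \<partial>lborel)"
      by (intro nn_integral_cmult) measurable
    also have "\<dots> \<le> ennreal (x powr (1 / p)) * ennreal (c * (1 / x) * ?B x)"
      by (intro mult_left_mono n_prim) auto
    also have "\<dots> = ennreal (c * (?B x * x powr (1 / p - 1)))"
      using x0 c young_inv_nonneg[OF A, of x] by (simp add: ennreal_mult[symmetric] powr_diff field_simps)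
    also have "\<dots> \<le> ennreal (c * ?D x)"
      using target_young_lower[OF C A p x0] c by (intro ennreal_leI mult_left_mono) auto
    finally show "(\<integral>\<^sup>+s. ?Q1 s \<partial>lborel) \<le> ennreal (c * ?D x)" .
  next
    have "(\<integral>\<^sup>+s. ?Q2 s \<partial>lborel) = ennreal (c / q * ?D x powr (1 - q)) *
         (\<integral>\<^sup>+s. ennreal (?B (max 0 (1 / s)) powr q) * indicator {1 / x..\<tau>} s \<partial>lborel)"
      by (intro nn_integral_cmult) measurable
    also have "\<dots> \<le> ennreal (c / q * ?D x powr (1 - q)) * ennreal (?D x powr q)"
      by (intro mult_left_mono kernel_tail[OF C A p q x0]) auto
    also have "\<dots> = ennreal (c / q * (?D x powr (1 - q) * ?D x powr q))"
      using c q1 by (simp add: ennreal_mult[symmetric])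
    also have "?D x powr (1 - q) * ?D x powr q = ?D x"
      using D0 by (simp add: powr_add[symmetric])
    finally show "(\<integral>\<^sup>+s. ?Q2 s \<partial>lborel) \<le> ennreal (c / q * ?D x)" .
  next
    have "(\<integral>\<^sup>+s. ?Q3 s \<partial>lborel) = ennreal (c / p * ?D x) * (\<integral>\<^sup>+s. ennreal (f (t - s) powr p) \<partial>lborel)"
      by (intro nn_integral_cmult) measurable
    also have "\<dots> \<le> ennreal (c / p * ?D x) * 1"
      using f_p nn_integral_shift[of "\<lambda>s. ennreal (f s powr p)" t] by (intro mult_left_mono) auto
    finally show "(\<integral>\<^sup>+s. ?Q3 s \<partial>lborel) \<le> ennreal (c / p * ?D x)" by simp
  next
    have "(\<integral>\<^sup>+s. ?Q4 s \<partial>lborel) = ennreal M *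
       ((\<integral>\<^sup>+s. indicator {0<..<T} (t - s) \<partial>lborel) + (\<integral>\<^sup>+s. ennreal (f (t - s) powr p) \<partial>lborel))"
      by (simp add: nn_integral_cmult nn_integral_add)
    also have "\<dots> \<le> ennreal M * (ennreal T + 1)"
      using f_p nn_integral_shift[of "\<lambda>s. ennreal (f s powr p)" t]
        nn_integral_shift[of "\<lambda>s. indicator {0<..<T} s" t] T by (intro mult_left_mono add_mono) auto
    also have "\<dots> = ennreal (M * (T + 1))"
      using M T by (simp add: ennreal_mult ennreal_plus)
    finally show "(\<integral>\<^sup>+s. ?Q4 s \<partial>lborel) \<le> ennreal (M * (T + 1))" .
  qed
  also have "ennreal (c * ?D x) + (ennreal (c / q * ?D x) + (ennreal (c / p * ?D x) + ennreal (M * (T + 1))))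
     = ennreal (c * ?D x + (c / q * ?D x + (c / p * ?D x + M * (T + 1))))"
    using c D0 p q1 M T by (simp add: ennreal_plus[symmetric] del: ennreal_plus)
  also have "c * ?D x + (c / q * ?D x + (c / p * ?D x + M * (T + 1)))
     = c * ?D x * (1 + (1 / p + 1 / q)) + M * (T + 1)"
    by (simp add: algebra_simps)
  also have "\<dots> = 2 * c * ?D x + M * (T + 1)"
    unfolding q1 by simp
  finally show ?thesis .
qed

text \<open>
  The constant \<open>K\<close> leaves a margin of \<open>c C\<^sup>-\<^sup>1(x)\<close> above the bound of \<open>convolution_split\<close>: where
  \<open>\<bar>J\<bar>\<close> exceeds \<open>K C\<^sup>-\<^sup>1(x)\<close>, the singular part exceeds this margin, and Markov's inequality applies.
  The denominator in \<open>K\<close> is the lower bound of \<open>target_young_lower\<close> for \<open>C\<^sup>-\<^sup>1(1/\<tau>)\<close>; it turns the constant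
  that comes from the bounded part of the kernel into a multiple of \<open>C\<^sup>-\<^sup>1(x)\<close> without \<open>C\<close> entering \<open>K\<close>.
\<close>

lemma convolution_modular_bound:
  fixes n f J :: "real \<Rightarrow> real" and c M p q T \<tau> K :: real
  assumes C: "target_young p A C" and A: "young_function A" and p: "1 < p" and q: "q = p / (p - 1)"
    and T: "0 < T" and \<tau>: "0 < \<tau>" and c: "0 < c" and M: "0 \<le> M"
    and [measurable]: "n \<in> borel_measurable borel" "f \<in> borel_measurable borel" "J \<in> borel_measurable borel"
    and n0: "\<And>s. 0 \<le> n s" and f0: "\<And>s. 0 \<le> f s"
    and n_neg: "\<And>s. s \<le> 0 \<Longrightarrow> n s = 0" and f_supp: "\<And>s. s \<notin> {0<..<T} \<Longrightarrow> f s = 0"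
    and n_prim: "\<And>\<delta>. 0 < \<delta> \<Longrightarrow> \<delta> < \<tau> \<Longrightarrow>
       (\<integral>\<^sup>+s. ennreal (n s) * indicator {0<..<\<delta>} s \<partial>lborel) \<le> ennreal (c * \<delta> * young_inv A (1 / \<delta>))"
    and n_le: "AE s in lborel. 0 < s \<longrightarrow> s < \<tau> \<longrightarrow> n s \<le> c * young_inv A (1 / s)"
    and n_bdd: "AE s in lborel. \<tau> < s \<longrightarrow> n s \<le> M"
    and f_p: "(\<integral>\<^sup>+s. ennreal (f s powr p) \<partial>lborel) \<le> 1"
    and J: "\<And>t. ennreal \<bar>J t\<bar> \<le> (\<integral>\<^sup>+s. ennreal (n s) * ennreal (f (t - s)) \<partial>lborel)"
    and K: "K = 3 * c + M * (T + 1) / (young_inv A (1 / \<tau>) * (1 / \<tau>) powr (1 / p - 1))"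
  shows "(\<integral>\<^sup>+t. ennreal (C (\<bar>J t\<bar> / K)) * indicator {0<..<T} t \<partial>lborel) \<le> ennreal (T / \<tau> + q)"
proof -
  let ?B = "young_inv A" and ?D = "young_inv C"
  have CY: "young_function C" using C by (simp add: target_young_def)
  note [measurable (raw)] = borel_measurable_young_inv_max[OF CY]
  have q0: "0 < q" using p by (simp add: q)
  define m where "m = ?B (1 / \<tau>) * (1 / \<tau>) powr (1 / p - 1)"
  have m0: "0 < m" using young_inv_pos[OF A, of "1 / \<tau>"] \<tau> by (simp add: m_def)
  have K': "K = 3 * c + M * (T + 1) / m" by (simp add: K m_def)
  have K0: "0 < K" using c M T m0 by (auto simp: K' add_pos_nonneg)
  let ?F = "\<lambda>x. \<integral>\<^sup>+s. ennreal (f s) * indicator {x powr (1 / p)<..} (f s) \<partial>lborel"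
  let ?L = "\<lambda>x. \<integral>\<^sup>+t. indicator {0<..<T} t * indicator {?D (max 0 x)<..} (\<bar>J t\<bar> / K) \<partial>lborel :: ennreal"
  \<comment> \<open>The bound used for \<open>x \<le> 1/\<tau>\<close>, where \<open>1/x\<close> lies outside the range of the hypothesis on \<open>N\<close>.\<close>
  have trivial: "?L x \<le> ennreal T" for x
  proof -
    have "?L x \<le> (\<integral>\<^sup>+t. indicator {0<..<T} t \<partial>lborel)"
      by (intro nn_integral_mono) (auto simp: indicator_def)
    also have "\<dots> = ennreal T" using T by simp
    finally show ?thesis .
  qed
  have level: "?L x \<le> ennreal (x powr (- (1 / p))) * ?F x" if x: "1 / \<tau> < x" for x
  proof -
    have x0: "0 < x" using x \<tau> by (meson less_trans zero_less_divide_1_iff)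
    have x1: "1 / x < \<tau>" using x x0 \<tau> by (simp add: field_simps)
    have D0: "0 < ?D x" using young_inv_pos[OF CY x0] .
    let ?P = "\<lambda>s. ennreal (n s) * indicator {0<..<1 / x} s"
    let ?R = "\<lambda>s. ennreal (f s) * indicator {x powr (1 / p)<..} (f s)"
    have prim: "(\<integral>\<^sup>+s. ?P s \<partial>lborel) \<le> ennreal (c * (1 / x) * ?B x)"
      using n_prim[of "1 / x"] x0 x1 by simp
    have "m \<le> ?D (1 / \<tau>)"
      using target_young_lower[OF C A p, of "1 / \<tau>"] \<tau> by (simp add: m_def)
    also have "\<dots> \<le> ?D x" using x \<tau> CY by (intro young_inv_mono) auto
    finally have "M * (T + 1) / m * m \<le> M * (T + 1) / m * ?D x"
      using M T m0 by (intro mult_left_mono) auto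
    then have "M * (T + 1) \<le> M * (T + 1) / m * ?D x" using m0 by simp
    then have low: "2 * c * ?D x + M * (T + 1) + c * ?D x \<le> K * ?D x"
      using m0 by (simp add: K' distrib_right)
    have "?L x \<le> (\<integral>\<^sup>+t. ennreal (1 / (c * ?D x)) * (\<integral>\<^sup>+s. ?P s * ?R (t - s) \<partial>lborel) \<partial>lborel)"
    proof (intro nn_integral_mono)
      fix t :: real
      show "indicator {0<..<T} t * indicator {?D (max 0 x)<..} (\<bar>J t\<bar> / K)
         \<le> ennreal (1 / (c * ?D x)) * (\<integral>\<^sup>+s. ?P s * ?R (t - s) \<partial>lborel)"
      proof (cases "?D x < \<bar>J t\<bar> / K")
        case True
        then have "K * ?D x < \<bar>J t\<bar>" using K0 by (simp add: field_simps)
        then have "ennreal (2 * c * ?D x + M * (T + 1) + c * ?D x) \<le> ennreal \<bar>J t\<bar>"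
          using low by (intro ennreal_leI) linarith
        also have "\<dots> \<le> (\<integral>\<^sup>+s. ?P s * ?R (t - s) \<partial>lborel) + ennreal (2 * c * ?D x + M * (T + 1))"
          using J[of t] convolution_split[OF C A p q T \<tau> c M x _ _ n0 f0 n_neg f_supp prim n_le n_bdd f_p, of t]
          by simp
        finally have "ennreal (2 * c * ?D x + M * (T + 1)) + ennreal (c * ?D x)
            \<le> ennreal (2 * c * ?D x + M * (T + 1)) + (\<integral>\<^sup>+s. ?P s * ?R (t - s) \<partial>lborel)"
          using c D0 M T by (simp add: ennreal_plus[symmetric] add.commute del: ennreal_plus)
        then have "ennreal (c * ?D x) \<le> (\<integral>\<^sup>+s. ?P s * ?R (t - s) \<partial>lborel)"
          by (simp add: ennreal_add_left_cancel_le)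
        then have "ennreal (1 / (c * ?D x)) * ennreal (c * ?D x)
            \<le> ennreal (1 / (c * ?D x)) * (\<integral>\<^sup>+s. ?P s * ?R (t - s) \<partial>lborel)"
          by (intro mult_left_mono) auto
        moreover have "ennreal (1 / (c * ?D x)) * ennreal (c * ?D x) = 1"
          using c D0 by (simp add: ennreal_mult[symmetric])
        ultimately show ?thesis by (auto simp: indicator_def)
      next
        case False
        then show ?thesis using x0 by (simp add: max_def)
      qed
    qed
    also have "\<dots> = ennreal (1 / (c * ?D x)) * (\<integral>\<^sup>+t. (\<integral>\<^sup>+s. ?P s * ?R (t - s) \<partial>lborel) \<partial>lborel)"
      by (intro nn_integral_cmult) (simp add: indicator_def greaterThan_def)
    also have "(\<integral>\<^sup>+t. (\<integral>\<^sup>+s. ?P s * ?R (t - s) \<partial>lborel) \<partial>lborel) = (\<integral>\<^sup>+s. ?P s \<partial>lborel) * ?F x"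
      by (intro nn_integral_convolution) (simp_all add: indicator_def greaterThan_def)
    also have "ennreal (1 / (c * ?D x)) * ((\<integral>\<^sup>+s. ?P s \<partial>lborel) * ?F x)
        \<le> ennreal (1 / (c * ?D x)) * (ennreal (c * (1 / x) * ?B x) * ?F x)"
      by (intro mult_left_mono mult_right_mono prim) auto
    also have "\<dots> = ennreal (1 / (c * ?D x) * (c * (1 / x) * ?B x)) * ?F x"
    proof -
      have "ennreal (1 / (c * ?D x) * (c * (1 / x) * ?B x)) = ennreal (1 / (c * ?D x)) * ennreal (c * (1 / x) * ?B x)"
        using c D0 x0 young_inv_nonneg[OF A, of x] by (intro ennreal_mult) auto
      then show ?thesis by (simp only: mult.assoc)
    qed
    also have "\<dots> \<le> ennreal (x powr (- (1 / p))) * ?F x"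
    proof (intro mult_right_mono ennreal_leI)
      have "1 / (c * ?D x) * (c * (1 / x) * ?B x) = 1 / ?D x * (?B x * x powr (1 / p - 1)) * x powr (- (1 / p))"
        using c D0 x0 by (simp add: powr_diff powr_minus field_simps)
      also have "\<dots> \<le> 1 / ?D x * ?D x * x powr (- (1 / p))"
        using D0 target_young_lower[OF C A p x0] by (intro mult_right_mono mult_left_mono) auto
      finally show "1 / (c * ?D x) * (c * (1 / x) * ?B x) \<le> x powr (- (1 / p))" using D0 by simp
    qed auto
    finally show ?thesis .
  qed
  have "(\<integral>\<^sup>+t. ennreal (C (\<bar>J t\<bar> / K)) * indicator {0<..<T} t \<partial>lborel) = (\<integral>\<^sup>+x. indicator {0<..} x * ?L x \<partial>lborel)"
    using K0 by (intro nn_integral_young_layer_cake CY) auto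
  also have "\<dots> \<le> (\<integral>\<^sup>+x. ennreal T * indicator {0..1 / \<tau>} x +
       ennreal (x powr (- (1 / p))) * indicator {1 / \<tau><..} x * ?F x \<partial>lborel)"
  proof (intro nn_integral_mono)
    fix x :: real
    consider "x \<le> 0" | "0 < x" "x \<le> 1 / \<tau>" | "0 < x" "1 / \<tau> < x" by linarith
    then show "indicator {0<..} x * ?L x \<le> ennreal T * indicator {0..1 / \<tau>} x +
       ennreal (x powr (- (1 / p))) * indicator {1 / \<tau><..} x * ?F x"
      by cases (use trivial[of x] level[of x] in simp_all)
  qed
  also have "\<dots> = (\<integral>\<^sup>+x. ennreal T * indicator {0..1 / \<tau>} x \<partial>lborel) +
       (\<integral>\<^sup>+x. ennreal (x powr (- (1 / p))) * indicator {1 / \<tau><..} x * ?F x \<partial>lborel)"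
    by (intro nn_integral_add) (simp_all add: indicator_def greaterThan_def)
  also have "\<dots> \<le> ennreal (T / \<tau>) + ennreal q * 1"
  proof (intro add_mono)
    show "(\<integral>\<^sup>+x. ennreal T * indicator {0..1 / \<tau>} x \<partial>lborel) \<le> ennreal (T / \<tau>)"
      using T \<tau> by (simp add: nn_integral_cmult_indicator ennreal_mult[symmetric])
    have "(\<integral>\<^sup>+x. ennreal (x powr (- (1 / p))) * indicator {1 / \<tau><..} x * ?F x \<partial>lborel)
      \<le> ennreal q * (\<integral>\<^sup>+s. ennreal (f s powr p) \<partial>lborel)"
      using \<tau> by (intro nn_integral_large_values f0 p q) auto
    also have "\<dots> \<le> ennreal q * 1"
      by (intro mult_left_mono f_p) auto
    finally show "(\<integral>\<^sup>+x. ennreal (x powr (- (1 / p))) * indicator {1 / \<tau><..} x * ?F x \<partial>lborel) \<le> ennreal q * 1" .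
  qed
  also have "\<dots> = ennreal (T / \<tau> + q)" using T \<tau> q0 by simp
  finally show ?thesis .
qed

section \<open>Borel representatives and hypotheses on the kernel\<close>

lemma nn_integral_lebesgue_on:
  assumes "S \<in> sets borel"
  shows "(\<integral>\<^sup>+s. F s \<partial>lebesgue_on S) = (\<integral>\<^sup>+s. F s * indicator S s \<partial>lborel)"
  using assms by (subst nn_integral_restrict_space) (auto simp: nn_integral_completion)

text \<open>
  Tonelli's theorem needs joint measurability of \<open>(s, t) \<mapsto> h(t - s)\<close> in the product of the Borel
  \<open>\<sigma>\<close>-algebras, so the kernel and the function are replaced by Borel functions on the whole line.
\<close>

lemma borel_representative:
  fixes h :: "real \<Rightarrow> real"
  assumes "h \<in> borel_measurable (lebesgue_on S)" and S: "S \<in> sets borel"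
  obtains h' where "h' \<in> borel_measurable borel" "\<And>s. s \<notin> S \<Longrightarrow> h' s = 0"
    "AE s in lborel. s \<in> S \<longrightarrow> h' s = h s"
proof -
  have "(\<lambda>s. if s \<in> S then h s else 0) \<in> borel_measurable lebesgue"
    using assms by (intro borel_measurable_if_I) auto
  then obtain k where k: "k \<in> borel_measurable lborel" "AE s in lborel. (if s \<in> S then h s else 0) = k s"
    using completion_ex_borel_measurable_real by blast
  show ?thesis
  proof (rule that[of "\<lambda>s. indicator S s * k s"])
    show "(\<lambda>s. indicator S s * k s) \<in> borel_measurable borel"
      using k(1) S by (intro borel_measurable_times) auto
    show "AE s in lborel. s \<in> S \<longrightarrow> indicator S s * k s = h s"
      using k(2) by eventually_elim (auto simp: indicator_def split: if_splits)
  qed auto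
qed

lemma AE_lborel_reflect:
  assumes "AE s in lborel. P s"
  shows "AE s in lborel. P (t - s :: real)"
proof -
  obtain N where N: "{s. \<not> P s} \<subseteq> N" "N \<in> null_sets lborel"
    using assms unfolding eventually_ae_filter by auto
  have "AE s in lborel. s \<notin> N" using N by (intro AE_not_in)
  then have "AE s in lborel. t + (-1) * s \<notin> N"
    using N by (intro AE_borel_affine) auto
  then show ?thesis by eventually_elim (use N in auto)
qed

text \<open>
  Null sets are invariant under \<open>s \<mapsto> t - s\<close>, so for every single \<open>t\<close> the integrands agree almost
  everywhere: the two convolutions are equal at every point, not merely almost everywhere.
\<close>

lemma convolution_representative:
  fixes \<nu> g n g' :: "real \<Rightarrow> real"
  assumes [measurable]: "n \<in> borel_measurable borel" "g' \<in> borel_measurable borel"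
    and n: "\<And>s. s \<notin> {0<..<T} \<Longrightarrow> n s = 0" "AE s in lborel. s \<in> {0<..<T} \<longrightarrow> n s = \<nu> s"
    and g: "\<And>s. s \<notin> {0<..<T} \<Longrightarrow> g' s = 0" "AE s in lborel. s \<in> {0<..<T} \<longrightarrow> g' s = g s"
    and t: "t \<in> {0<..<T}"
  shows "J_op \<nu> g t = (LINT s|lborel. n (t - s) * g' s)"
    and "integrable (lebesgue_on {0<..<t}) (\<lambda>s. \<nu> (t - s) * g s) \<longleftrightarrow> integrable lborel (\<lambda>s. n (t - s) * g' s)"
proof -
  let ?h = "\<lambda>s. n (t - s) * g' s" and ?k = "\<lambda>s. indicator {0<..<t} s *\<^sub>R (\<nu> (t - s) * g s)"
  have h: "?h \<in> borel_measurable lebesgue"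
    by (intro measurable_completion) measurable
  have "AE s in lborel. ?h s = ?k s"
    using AE_lborel_reflect[OF n(2), of t] g(2)
  proof eventually_elim
    case (elim s)
    consider "s \<le> 0" | "t \<le> s" | "s \<in> {0<..<t}" by force
    then show ?case
      by cases (use elim n(1)[of "t - s"] g(1)[of s] t in auto)
  qed
  then have AE: "AE s in lebesgue. ?h s = ?k s" by (rule AE_completion)
  then have k: "?k \<in> borel_measurable lebesgue"
    by (rule borel_measurable_AE[OF h])
  show "J_op \<nu> g t = (LINT s|lborel. ?h s)"
    unfolding J_op_def using integral_cong_AE[OF h k AE]
    by (simp add: integral_restrict_space integral_completion)
  show "integrable (lebesgue_on {0<..<t}) (\<lambda>s. \<nu> (t - s) * g s) \<longleftrightarrow> integrable lborel ?h"
    using integrable_cong_AE[OF h k AE]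
    by (simp add: integrable_restrict_space integrable_completion)
qed

lemma nn_integral_eq_primitive:
  assumes \<nu>: "integrable (lebesgue_on {0<..<T}) \<nu>" and pos: "\<forall>x\<in>{0<..<T}. 0 < \<nu> x" and "\<delta> \<le> T"
  shows "(\<integral>\<^sup>+s. ennreal (\<nu> s) * indicator {0<..<\<delta>} s \<partial>lborel) = ennreal (primitive \<nu> \<delta>)"
proof -
  have "integrable lebesgue (\<lambda>s. indicator {0<..<T} s *\<^sub>R \<nu> s)"
    using \<nu> by (simp add: integrable_restrict_space)
  then have "integrable lebesgue (\<lambda>s. indicator {0<..<\<delta>} s *\<^sub>R (indicator {0<..<T} s *\<^sub>R \<nu> s))"
    by (rule integrable_mult_indicator[rotated]) simp
  also have "(\<lambda>s. indicator {0<..<\<delta>} s *\<^sub>R (indicator {0<..<T} s *\<^sub>R \<nu> s)) = (\<lambda>s. indicator {0<..<\<delta>} s *\<^sub>R \<nu> s)"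
    using \<open>\<delta> \<le> T\<close> by (auto simp: indicator_def)
  finally have "integrable (lebesgue_on {0<..<\<delta>}) \<nu>"
    by (simp add: integrable_restrict_space)
  then have "(\<integral>\<^sup>+s. ennreal (\<nu> s) \<partial>lebesgue_on {0<..<\<delta>}) = ennreal (primitive \<nu> \<delta>)"
    unfolding primitive_def using pos \<open>\<delta> \<le> T\<close>
    by (intro nn_integral_eq_integral AE_I2) (auto intro: less_imp_le)
  then show ?thesis by (simp add: nn_integral_lebesgue_on)
qed

lemma decreasing_le_primitive:
  assumes \<nu>: "integrable (lebesgue_on {0<..<T}) \<nu>" and pos: "\<forall>x\<in>{0<..<T}. 0 < \<nu> x"
    and "\<tau> \<le> T" and dec: "antimono_on {0<..<\<tau>} \<nu>" and s: "s \<in> {0<..<\<tau>}"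
  shows "\<nu> s * s \<le> primitive \<nu> s"
proof -
  have "ennreal (\<nu> s * s) = (\<integral>\<^sup>+r. ennreal (\<nu> s) * indicator {0<..<s} r \<partial>lborel)"
    using s pos \<open>\<tau> \<le> T\<close> by (simp add: nn_integral_cmult_indicator ennreal_mult less_imp_le)
  also have "\<dots> \<le> (\<integral>\<^sup>+r. ennreal (\<nu> r) * indicator {0<..<s} r \<partial>lborel)"
    using s monotone_onD[OF dec, of _ s]
    by (intro nn_integral_mono) (auto simp: indicator_def intro!: ennreal_leI)
  also have "\<dots> = ennreal (primitive \<nu> s)"
    using s \<open>\<tau> \<le> T\<close> by (intro nn_integral_eq_primitive[OF \<nu> pos]) auto
  finally have *: "ennreal (\<nu> s * s) \<le> ennreal (primitive \<nu> s)" .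
  have "0 < \<nu> s * s" using s pos \<open>\<tau> \<le> T\<close> by auto
  then show ?thesis using * by (cases "0 \<le> primitive \<nu> s") (auto simp: ennreal_neg)
qed

lemma nn_integral_scaled_powr_le_1:
  assumes g: "g \<in> Lp_space p T" and p: "1 < p"
    and g'0: "\<And>s. s \<notin> {0<..<T} \<Longrightarrow> g' s = 0" and g'g: "AE s in lborel. s \<in> {0<..<T} \<longrightarrow> g' s = g s"
    and R: "0 < R" "Lp_norm p T g \<le> R"
  shows "(\<integral>\<^sup>+s. ennreal ((\<bar>g' s\<bar> / R) powr p) \<partial>lborel) \<le> 1"
proof -
  let ?I = "LINT s|lebesgue_on {0<..<T}. \<bar>g s\<bar> powr p"
  have "0 \<le> ?I" by (intro integral_nonneg_AE) auto
  have "?I = (?I powr (1 / p)) powr p"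
    using \<open>0 \<le> ?I\<close> p by (simp add: powr_powr)
  also have "\<dots> \<le> R powr p"
    using R p by (intro powr_mono2) (auto simp: Lp_norm_def)
  finally have I: "?I \<le> R powr p" .
  have "(\<integral>\<^sup>+s. ennreal ((\<bar>g' s\<bar> / R) powr p) \<partial>lborel)
      = (\<integral>\<^sup>+s. ennreal (\<bar>g s\<bar> powr p / R powr p) * indicator {0<..<T} s \<partial>lborel)"
    using g'g
    by (intro nn_integral_cong_AE, eventually_elim)
      (use R p g'0 in \<open>auto simp: indicator_def powr_divide\<close>)
  also have "\<dots> = (\<integral>\<^sup>+s. ennreal (\<bar>g s\<bar> powr p / R powr p) \<partial>lebesgue_on {0<..<T})"
    by (simp add: nn_integral_lebesgue_on)
  also have "\<dots> = ennreal (LINT s|lebesgue_on {0<..<T}. \<bar>g s\<bar> powr p / R powr p)"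
    using g by (intro nn_integral_eq_integral integrable_divide AE_I2) (auto simp: Lp_space_def)
  also have "\<dots> = ennreal (?I / R powr p)" by simp
  also have "\<dots> \<le> 1" using I R by (subst ennreal_le_1) (simp add: field_simps)
  finally show ?thesis .
qed

text \<open>
  \<open>L\<^sup>p\<close> is contained in \<open>L\<^sup>1\<close> on a bounded interval, by \<open>y \<le> 1 + y\<^sup>p\<close>.
\<close>

lemma nn_integral_finite_of_Lp:
  assumes g: "g \<in> Lp_space p T" and p: "1 < p"
    and g'0: "\<And>s. s \<notin> {0<..<T} \<Longrightarrow> g' s = 0" and g'g: "AE s in lborel. s \<in> {0<..<T} \<longrightarrow> g' s = g s"
    and [measurable]: "g' \<in> borel_measurable borel"
  shows "(\<integral>\<^sup>+s. ennreal \<bar>g' s\<bar> \<partial>lborel) < \<infinity>"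
proof -
  define R where "R = Lp_norm p T g + 1"
  have R: "0 < R" "Lp_norm p T g \<le> R" by (auto simp: R_def Lp_norm_def add_nonneg_pos)
  have "(\<integral>\<^sup>+s. ennreal \<bar>g' s\<bar> \<partial>lborel)
     \<le> (\<integral>\<^sup>+s. ennreal R * (indicator {0<..<T} s + ennreal ((\<bar>g' s\<bar> / R) powr p)) \<partial>lborel)"
  proof (intro nn_integral_mono)
    fix s
    have "\<bar>g' s\<bar> / R \<le> indicator {0<..<T} s + (\<bar>g' s\<bar> / R) powr p"
    proof (cases "\<bar>g' s\<bar> / R \<le> 1")
      case True
      then show ?thesis using g'0[of s] by (auto simp: indicator_def add_increasing2)
    next
      case False
      then have "(\<bar>g' s\<bar> / R) powr 1 \<le> (\<bar>g' s\<bar> / R) powr p" using p by (intro powr_mono) auto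
      then show ?thesis using False R by (auto simp: indicator_def)
    qed
    then have "\<bar>g' s\<bar> \<le> R * (indicator {0<..<T} s + (\<bar>g' s\<bar> / R) powr p)"
      using R by (simp only: pos_divide_le_eq mult.commute)
    then have "ennreal \<bar>g' s\<bar> \<le> ennreal (R * (indicator {0<..<T} s + (\<bar>g' s\<bar> / R) powr p))"
      by (rule ennreal_leI)
    also have "\<dots> = ennreal R * (indicator {0<..<T} s + ennreal ((\<bar>g' s\<bar> / R) powr p))"
      using R by (simp add: ennreal_mult ennreal_plus ennreal_indicator)
    finally show "ennreal \<bar>g' s\<bar> \<le> ennreal R * (indicator {0<..<T} s + ennreal ((\<bar>g' s\<bar> / R) powr p))" .
  qed
  also have "\<dots> = ennreal R * ((\<integral>\<^sup>+s. indicator {0<..<T} s \<partial>lborel) + (\<integral>\<^sup>+s. ennreal ((\<bar>g' s\<bar> / R) powr p) \<partial>lborel))"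
    by (simp add: nn_integral_cmult nn_integral_add)
  also have "\<dots> \<le> ennreal R * (emeasure lborel {0<..<T} + 1)"
    using nn_integral_scaled_powr_le_1[OF g p g'0 g'g R] by (intro mult_left_mono add_mono) auto
  also have "\<dots> < \<infinity>"
    by (cases "0 \<le> T") (auto simp: ennreal_mult_less_top)
  finally show ?thesis .
qed

section \<open>Boundedness of the convolution operator\<close>

text \<open>
  Dividing the argument by \<open>k \<ge> 1\<close> divides the modular by at least \<open>k\<close>, by \<open>young_scale\<close>.
\<close>

lemma orlicz_norm_le_of_modular:
  assumes C: "young_function C" and L: "0 < L" and k: "1 \<le> k"
    and mod: "(\<integral>\<^sup>+t. ennreal (C (\<bar>h t\<bar> / L)) * indicator {0<..<T} t \<partial>lborel) \<le> ennreal k"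
    and [measurable]: "h \<in> borel_measurable borel"
  shows "orlicz_norm C T h \<le> ennreal (k * L)"
proof -
  have "(\<lambda>y. C (max 0 y)) \<in> borel_measurable borel"
  proof (intro borel_measurable_mono monoI)
    fix x y :: real assume "x \<le> y"
    then show "C (max 0 x) \<le> C (max 0 y)"
      using young_less_iff[OF C, of "max 0 y" "max 0 x"] by (simp add: not_less[symmetric])
  qed
  then have "(\<lambda>t. C (max 0 (\<bar>h t\<bar> / L))) \<in> borel_measurable borel"
    by (rule measurable_compose[rotated]) measurable
  then have [measurable]: "(\<lambda>t. C (\<bar>h t\<bar> / L)) \<in> borel_measurable borel"
    using L by (simp add: max_def)
  have "(\<integral>\<^sup>+t. ennreal (C (\<bar>h t\<bar> / (k * L))) \<partial>lebesgue_on {0<..<T})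
      = (\<integral>\<^sup>+t. ennreal (C (\<bar>h t\<bar> / (k * L))) * indicator {0<..<T} t \<partial>lborel)"
    by (simp add: nn_integral_lebesgue_on)
  also have "\<dots> \<le> (\<integral>\<^sup>+t. ennreal (1 / k) * (ennreal (C (\<bar>h t\<bar> / L)) * indicator {0<..<T} t) \<partial>lborel)"
  proof (intro nn_integral_mono)
    fix t
    have "C (\<bar>h t\<bar> / (k * L)) \<le> 1 / k * C (\<bar>h t\<bar> / L)"
      using young_scale[OF C, of "1 / k" "\<bar>h t\<bar> / L"] k L by simp
    then have "ennreal (C (\<bar>h t\<bar> / (k * L))) \<le> ennreal (1 / k * C (\<bar>h t\<bar> / L))"
      by (rule ennreal_leI)
    also have "\<dots> = ennreal (1 / k) * ennreal (C (\<bar>h t\<bar> / L))"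
      using k L young_nonneg[OF C] by (intro ennreal_mult) auto
    finally show "ennreal (C (\<bar>h t\<bar> / (k * L))) * indicator {0<..<T} t
       \<le> ennreal (1 / k) * (ennreal (C (\<bar>h t\<bar> / L)) * indicator {0<..<T} t)"
      by (auto simp: indicator_def)
  qed
  also have "\<dots> = ennreal (1 / k) * (\<integral>\<^sup>+t. ennreal (C (\<bar>h t\<bar> / L)) * indicator {0<..<T} t \<partial>lborel)"
    by (intro nn_integral_cmult) measurable
  also have "\<dots> \<le> ennreal (1 / k) * ennreal k"
    by (intro mult_left_mono mod) auto
  also have "\<dots> = 1" using k by (simp add: ennreal_mult[symmetric])
  finally show ?thesis
    unfolding orlicz_norm_def using k L by (intro INF_lower2[of "k * L"]) auto
qed

theorem theorem4p1:
  fixes p T :: real and A \<nu> :: "real \<Rightarrow> real"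
  assumes "1 < p" and "0 < T"
    and "young_function A"
    and "integrable (lebesgue_on {0<..<T}) \<nu>"
    and "\<forall>x\<in>{0<..<T}. 0 < \<nu> x"
    and "\<exists>\<tau>0. 0 < \<tau>0 \<and> \<tau>0 \<le> T \<and>
           antimono_on {0<..<\<tau>0} \<nu> \<and>
           (\<tau>0 < T \<longrightarrow> bounded (\<nu> ` {\<tau>0<..<T})) \<and>
           (\<exists>c\<nu>>0. \<forall>t\<in>{0<..<\<tau>0}. primitive \<nu> t \<le> c\<nu> * t * young_inv A (1 / t))"
  shows "\<exists>c>0. \<forall>C. target_young p A C \<longrightarrow>
           (\<forall>g\<in>Lp_space p T.
              (AE t in lebesgue_on {0<..<T}.
                 integrable (lebesgue_on {0<..<t}) (\<lambda>s. \<nu> (t - s) * g s)) \<and>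
              J_op \<nu> g \<in> orlicz_space C T \<and>
              orlicz_norm C T (J_op \<nu> g) \<le> ennreal (c * Lp_norm p T g))"
proof -
  note p = assms(1) and T = assms(2) and A = assms(3) and \<nu> = assms(4) and pos = assms(5)
  obtain \<tau> c where \<tau>: "0 < \<tau>" "\<tau> \<le> T" and dec: "antimono_on {0<..<\<tau>} \<nu>"
    and bdd: "\<tau> < T \<longrightarrow> bounded (\<nu> ` {\<tau><..<T})" and c: "0 < c"
    and prim: "\<And>t. t \<in> {0<..<\<tau>} \<Longrightarrow> primitive \<nu> t \<le> c * t * young_inv A (1 / t)"
    using assms(6) by blast
  obtain M where M: "0 \<le> M" "\<And>s. \<tau> < s \<Longrightarrow> s < T \<Longrightarrow> \<nu> s \<le> M"
  proof (cases "\<tau> < T")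
    case True
    then obtain M where M: "\<forall>y\<in>\<nu> ` {\<tau><..<T}. norm y \<le> M"
      using bdd unfolding bounded_iff by blast
    show ?thesis
    proof (rule that[of "max 0 M"])
      fix s assume "\<tau> < s" "s < T"
      then have "norm (\<nu> s) \<le> M" using M by simp
      then show "\<nu> s \<le> max 0 M" by simp
    qed simp
  qed (use that[of 0] in auto)
  \<comment> \<open>\<open>K\<close> and \<open>k\<close> are the constants of \<open>convolution_modular_bound\<close>; neither depends on \<open>C\<close> or \<open>g\<close>.\<close>
  define q where "q = p / (p - 1)"
  define k where "k = T / \<tau> + q"
  define K where "K = 3 * c + M * (T + 1) / (young_inv A (1 / \<tau>) * (1 / \<tau>) powr (1 / p - 1))"
  have "1 < q" using p by (simp add: q_def field_simps)
  then have k1: "1 \<le> k" using T \<tau> by (simp add: k_def add_increasing)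
  have K0: "0 < K"
    using c M T \<tau> young_inv_pos[OF A, of "1 / \<tau>"] by (auto simp: K_def intro!: add_pos_nonneg)
  obtain n' where n': "n' \<in> borel_measurable borel" "\<And>s. s \<notin> {0<..<T} \<Longrightarrow> n' s = 0"
    "AE s in lborel. s \<in> {0<..<T} \<longrightarrow> n' s = \<nu> s"
    by (rule borel_representative[OF borel_measurable_integrable[OF \<nu>]]) auto
  \<comment> \<open>The absolute value makes the representative nonnegative everywhere.\<close>
  define n where "n = (\<lambda>s. \<bar>n' s\<bar>)"
  have nM [measurable]: "n \<in> borel_measurable borel" using n'(1) unfolding n_def by measurable
  have n0: "\<And>s. 0 \<le> n s" and n_out: "\<And>s. s \<notin> {0<..<T} \<Longrightarrow> n s = 0"
    using n'(2) by (auto simp: n_def)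
  have n\<nu>: "AE s in lborel. s \<in> {0<..<T} \<longrightarrow> n s = \<nu> s"
    using n'(3) by eventually_elim (use pos in \<open>force simp: n_def\<close>)
  have n_prim: "(\<integral>\<^sup>+s. ennreal (n s) * indicator {0<..<\<delta>} s \<partial>lborel) = ennreal (primitive \<nu> \<delta>)"
    if "\<delta> \<le> T" for \<delta>
  proof -
    have "(\<integral>\<^sup>+s. ennreal (n s) * indicator {0<..<\<delta>} s \<partial>lborel)
        = (\<integral>\<^sup>+s. ennreal (\<nu> s) * indicator {0<..<\<delta>} s \<partial>lborel)"
      using n\<nu> by (intro nn_integral_cong_AE, eventually_elim) (use that in \<open>auto simp: indicator_def\<close>)
    then show ?thesis using nn_integral_eq_primitive[OF \<nu> pos that] by simp
  qed
  have n_le: "AE s in lborel. 0 < s \<longrightarrow> s < \<tau> \<longrightarrow> n s \<le> c * young_inv A (1 / s)"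
    using n\<nu>
  proof (eventually_elim, intro impI)
    fix s assume *: "s \<in> {0<..<T} \<longrightarrow> n s = \<nu> s" and s: "0 < s" "s < \<tau>"
    have "\<nu> s * s \<le> primitive \<nu> s"
      using decreasing_le_primitive[OF \<nu> pos \<tau>(2) dec] s by simp
    also have "\<dots> \<le> c * s * young_inv A (1 / s)" using prim[of s] s by simp
    finally have "\<nu> s * s \<le> (c * young_inv A (1 / s)) * s" by (simp add: ac_simps)
    then show "n s \<le> c * young_inv A (1 / s)" using * s \<tau> by simp
  qed
  have n_bdd: "AE s in lborel. \<tau> < s \<longrightarrow> n s \<le> M"
    using n\<nu>
  proof (eventually_elim, intro impI)
    fix s assume *: "s \<in> {0<..<T} \<longrightarrow> n s = \<nu> s" and s: "\<tau> < s"
    show "n s \<le> M" using * s \<tau> M n_out[of s] by (cases "s < T") auto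
  qed
  have n_int: "(\<integral>\<^sup>+s. ennreal (n s) \<partial>lborel) < \<infinity>"
  proof -
    have "(\<integral>\<^sup>+s. ennreal (n s) \<partial>lborel) = (\<integral>\<^sup>+s. ennreal (n s) * indicator {0<..<T} s \<partial>lborel)"
      by (intro nn_integral_cong) (use n_out in \<open>auto simp: indicator_def\<close>)
    then show ?thesis using n_prim[of T] by simp
  qed
  show ?thesis
  proof (intro exI[of _ "k * K"] conjI allI impI ballI)
    show "0 < k * K" using k1 K0 by simp
  next
    fix C g assume C: "target_young p A C" and g: "g \<in> Lp_space p T"
    have CY: "young_function C" using C by (simp add: target_young_def)
    have "g \<in> borel_measurable (lebesgue_on {0<..<T})" using g by (simp add: Lp_space_def)
    then obtain g' where g'M [measurable]: "g' \<in> borel_measurable borel"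
      and g'_out: "\<And>s. s \<notin> {0<..<T} \<Longrightarrow> g' s = 0"
      and g'g: "AE s in lborel. s \<in> {0<..<T} \<longrightarrow> g' s = g s"
      by (rule borel_representative) auto
    have rep: "J_op \<nu> g t = (LINT s|lborel. n (t - s) * g' s)"
      "integrable (lebesgue_on {0<..<t}) (\<lambda>s. \<nu> (t - s) * g s) \<longleftrightarrow> integrable lborel (\<lambda>s. n (t - s) * g' s)"
      if "t \<in> {0<..<T}" for t
      using convolution_representative[OF nM g'M n_out n\<nu> g'_out g'g that] by simp_all
    define J where "J = (\<lambda>t. LINT s|lborel. n (t - s) * g' s)"
    have JM [measurable]: "J \<in> borel_measurable borel"
      unfolding J_def by (rule borel_measurable_convolution) measurable
    let ?H = "\<lambda>t. \<integral>\<^sup>+s. ennreal (n s) * ennreal \<bar>g' (t - s)\<bar> \<partial>lborel"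
    have H: "(\<integral>\<^sup>+s. ennreal (norm (n (t - s) * g' s)) \<partial>lborel) = ?H t" for t
      using nn_integral_convolution_commute[of "\<lambda>s. ennreal (n s)" "\<lambda>s. ennreal \<bar>g' s\<bar>" t] n0
      by (simp add: abs_mult ennreal_mult)
    have JH: "ennreal \<bar>J t\<bar> \<le> ?H t" for t
    proof (cases "integrable lborel (\<lambda>s. n (t - s) * g' s)")
      case True
      then show ?thesis
        using integral_norm_bound_ennreal[OF True] by (simp add: J_def H[symmetric])
    qed (simp add: J_def not_integrable_integral_eq)
    \<comment> \<open>Scaling by any \<open>R\<close> above the norm of \<open>g\<close>, rather than by the norm itself, covers \<open>\<parallel>g\<parallel>\<^sub>p = 0\<close>.\<close>
    have bound: "orlicz_norm C T J \<le> ennreal (k * (K * R))" if R: "0 < R" "Lp_norm p T g \<le> R" for R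
    proof (rule orlicz_norm_le_of_modular[OF CY _ k1 _ JM])
      show "0 < K * R" using K0 R by simp
      have "(\<integral>\<^sup>+t. ennreal (C (\<bar>J t / R\<bar> / K)) * indicator {0<..<T} t \<partial>lborel) \<le> ennreal (T / \<tau> + q)"
      proof (rule convolution_modular_bound[OF C A p q_def T \<tau>(1) c M(1) nM _ _ n0 _ _ _ _ n_le n_bdd _ _ K_def])
        show "(\<lambda>s. \<bar>g' s\<bar> / R) \<in> borel_measurable borel" "(\<lambda>t. J t / R) \<in> borel_measurable borel"
          by measurable
        show "(\<integral>\<^sup>+s. ennreal ((\<bar>g' s\<bar> / R) powr p) \<partial>lborel) \<le> 1"
          by (rule nn_integral_scaled_powr_le_1[OF g p g'_out g'g R])
        show "(\<integral>\<^sup>+s. ennreal (n s) * indicator {0<..<\<delta>} s \<partial>lborel) \<le> ennreal (c * \<delta> * young_inv A (1 / \<delta>))"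
          if "0 < \<delta>" "\<delta> < \<tau>" for \<delta>
          using that n_prim[of \<delta>] prim[of \<delta>] \<tau> by (auto intro: ennreal_leI)
        show "ennreal \<bar>J t / R\<bar> \<le> (\<integral>\<^sup>+s. ennreal (n s) * ennreal (\<bar>g' (t - s)\<bar> / R) \<partial>lborel)" for t
        proof -
          have "ennreal \<bar>J t / R\<bar> = ennreal (1 / R) * ennreal \<bar>J t\<bar>"
            using R by (simp add: ennreal_mult[symmetric])
          also have "\<dots> \<le> ennreal (1 / R) * ?H t"
            by (intro mult_left_mono JH) auto
          also have "\<dots> = (\<integral>\<^sup>+s. ennreal (1 / R) * (ennreal (n s) * ennreal \<bar>g' (t - s)\<bar>) \<partial>lborel)"
            by (intro nn_integral_cmult[symmetric]) measurable
          also have "\<dots> = (\<integral>\<^sup>+s. ennreal (n s) * ennreal (\<bar>g' (t - s)\<bar> / R) \<partial>lborel)"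
            using R n0 by (intro nn_integral_cong) (simp add: ennreal_mult[symmetric])
          finally show ?thesis .
        qed
      qed (use R n_out g'_out in auto)
      then show "(\<integral>\<^sup>+t. ennreal (C (\<bar>J t\<bar> / (K * R))) * indicator {0<..<T} t \<partial>lborel) \<le> ennreal k"
        using R by (simp add: k_def mult.commute)
    qed
    have norm_eq: "orlicz_norm C T (J_op \<nu> g) = orlicz_norm C T J"
    proof -
      have "(\<integral>\<^sup>+t. ennreal (C (\<bar>J_op \<nu> g t\<bar> / l)) \<partial>lebesgue_on {0<..<T})
          = (\<integral>\<^sup>+t. ennreal (C (\<bar>J t\<bar> / l)) \<partial>lebesgue_on {0<..<T})" for l
        by (intro nn_integral_cong) (use rep(1) in \<open>simp add: J_def\<close>)
      then show ?thesis by (simp add: orlicz_norm_def)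
    qed
    have G0: "0 \<le> Lp_norm p T g" by (simp add: Lp_norm_def)
    show "AE t in lebesgue_on {0<..<T}. integrable (lebesgue_on {0<..<t}) (\<lambda>s. \<nu> (t - s) * g s)"
    proof -
      have "(\<integral>\<^sup>+t. ?H t \<partial>lborel) = (\<integral>\<^sup>+s. ennreal (n s) \<partial>lborel) * (\<integral>\<^sup>+s. ennreal \<bar>g' s\<bar> \<partial>lborel)"
        by (intro nn_integral_convolution) measurable
      also have "\<dots> < \<infinity>"
        using n_int nn_integral_finite_of_Lp[OF g p g'_out g'g g'M] by (simp add: ennreal_mult_less_top)
      finally have "AE t in lborel. ?H t \<noteq> \<infinity>"
        by (intro nn_integral_PInf_AE) auto
      then have "AE t in lebesgue. ?H t \<noteq> \<infinity>" by (rule AE_completion)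
      then have "AE t in lebesgue. t \<in> {0<..<T} \<longrightarrow> integrable (lebesgue_on {0<..<t}) (\<lambda>s. \<nu> (t - s) * g s)"
      proof (eventually_elim, intro impI)
        fix t assume "?H t \<noteq> \<infinity>" and t: "t \<in> {0<..<T}"
        then have "integrable lborel (\<lambda>s. n (t - s) * g' s)"
          unfolding integrable_iff_bounded H by (auto simp: less_top)
        then show "integrable (lebesgue_on {0<..<t}) (\<lambda>s. \<nu> (t - s) * g s)"
          using rep(2)[OF t] by simp
      qed
      then show ?thesis by (subst AE_restrict_space_iff) auto
    qed
    show "J_op \<nu> g \<in> orlicz_space C T"
    proof -
      have "J \<in> borel_measurable (lebesgue_on {0<..<T})"
        by (intro measurable_restrict_space1 measurable_completion) measurable
      then have "J_op \<nu> g \<in> borel_measurable (lebesgue_on {0<..<T})"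
        by (subst measurable_cong[of _ _ J]) (use rep(1) in \<open>simp_all add: J_def\<close>)
      moreover have "orlicz_norm C T J < \<infinity>"
        using bound[of "Lp_norm p T g + 1"] G0 by (auto simp: le_less_trans)
      ultimately show ?thesis by (simp add: orlicz_space_def norm_eq)
    qed
    show "orlicz_norm C T (J_op \<nu> g) \<le> ennreal (k * K * Lp_norm p T g)"
      unfolding norm_eq
    proof (rule ennreal_le_epsilon)
      fix e :: real assume e: "0 < e"
      \<comment> \<open>The excess of \<open>R\<close> over the norm contributes exactly \<open>e\<close> after multiplication by \<open>k K\<close>.\<close>
      define R where "R = Lp_norm p T g + e / (k * K)"
      have "0 < k * K" using k1 K0 by simp
      then have "orlicz_norm C T J \<le> ennreal (k * (K * R))"
        using G0 e by (intro bound) (auto simp: R_def add_nonneg_pos)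
      also have "k * (K * R) = k * K * Lp_norm p T g + e"
        using k1 K0 by (simp add: R_def field_simps)
      also have "ennreal \<dots> = ennreal (k * K * Lp_norm p T g) + ennreal e"
        using \<open>0 < k * K\<close> G0 e by (intro ennreal_plus) auto
      finally show "orlicz_norm C T J \<le> ennreal (k * K * Lp_norm p T g) + ennreal e" .
    qed
  qed
qed

end
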